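(* Consider $\dot{\vec{x}}=\vec{f}(\vec{x})+\epsilon\,\vec{g}(\vec{x},t)$ on $\Omega\subset\mathbb{R}^3$, with $0<\epsilon\ll1$, under the standing assumptions listed in the context, with two-dimensional heteroclinic manifold $\Gamma$ for $\epsilon=0$ parametrized by $\bar{\vec x}(p,\alpha)$. Then the instantaneous (signed) flux $\Phi(p,t,\epsilon)$ (volume per unit time) exiting the pseudo-separatrix $\tilde\Gamma(p,t,\epsilon)$, both defined in the context, is $$\Phi(p,t,\epsilon)=\epsilon\int_0^1M(p,\alpha,t)\,\mathrm{d}\alpha+\mathcal{O}(\epsilon^2),$$ where $$M(p,\alpha,t)=\int_{-\infty}^{\infty}\exp\left[\int_{\tau}^p(\nabla\cdot\vec{f})(\bar{\vec{x}}(\xi,\alpha))\,\mathrm{d}\xi\right]\left[\vec{f}(\bar{\vec{x}}(\tau,\alpha))\wedge\bar{\vec{x}}_{\alpha}(\tau,\alpha)\right]\cdot\vec{g}(\bar{\vec{x}}(\tau,\alpha),\tau+t-p)\,\mathrm{d}\tau.$$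
   Context: Here $\wedge$ is the cross product in $\mathbb{R}^3$, a subscript $\alpha$ or $s$ on a vector function denotes a partial derivative (the superscripts $u,s$ mean unstable, stable), and $\mathrm{S}^1=[0,1)$ extended periodically with period $1$. $\mathcal{O}(\cdot)$ refers to $\epsilon\to0$. Standing assumptions. $\vec f:\Omega\to\mathbb{R}^3$ is $C^2$ with $D\vec f$ bounded on $\Omega$. For each $t\in\mathbb{R}$, $\vec g(\cdot,t)\in C^2(\Omega)$, and $\vec g$, $D\vec g$ (spatial derivative) are bounded on $\Omega\times\mathbb{R}$. $\vec a\ne\vec b$ are fixed points of $\dot{\vec x}=\vec f(\vec x)$; $D\vec f(\vec a)$ has one negative eigenvalue and two eigenvalues with positive real parts, $D\vec f(\vec b)$ has one positive eigenvalue and two eigenvalues with negative real parts, and in each case the eigenvectors associated with the two-dimensional (unstable, resp. stable) subspace are linearly independent. The two-dimensional unstable manifold of $\vec a$ and the two-dimensional stable manifold of $\vec b$ are $C^2$-smooth and coincide to form a two-dimensional orientable heteroclinic manifold $\Gamma$, a closed surface (together with $\vec a,\vec b$) separating an inside from an outside. Parametrization. $\Gamma$ is foliated by heteroclinic trajectories labelled by $\alpha\in\mathrm{S}^1$, with $p\in\mathbb{R}$ the time along the trajectory: $\partial_p\bar{\vec x}(p,\alpha)=\vec f(\bar{\vec x}(p,\alpha))$, $\lim_{p\to-\infty}\bar{\vec x}(p,\alpha)=\vec a$, $\lim_{p\to\infty}\bar{\vec x}(p,\alpha)=\vec b$. The parametrization $(p,\alpha)\in\mathbb{R}\times\mathrm{S}^1$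 is $C^2$-smooth, and $\vec f(\bar{\vec x}(p,\alpha))\wedge\bar{\vec x}_\alpha(p,\alpha)$ is nonzero and points outward from $\Gamma$; $\hat{\vec n}(p,\alpha)$ denotes its normalization. Perturbed manifolds. For small $\epsilon$, $\vec a$ and $\vec b$ persist as hyperbolic trajectories $\vec a_\epsilon(t)$, $\vec b_\epsilon(t)$, with unstable manifold $\Gamma^u_\epsilon(\vec a_\epsilon,t)$ and stable manifold $\Gamma^s_\epsilon(\vec b_\epsilon,t)$ (time-slices at $t$). For $(p,t)$ in a bounded range, let $d^u(p,\alpha,\epsilon,t)$ and $d^s(p,\alpha,\epsilon,t)$ be the signed distances along $\hat{\vec n}(p,\alpha)$ from $\bar{\vec x}(p,\alpha)$ to the nearby points of $\Gamma^u_\epsilon(\vec a_\epsilon,t)$ and $\Gamma^s_\epsilon(\vec b_\epsilon,t)$. It is known that $d^{u}=\epsilon M^{u}/|\vec f(\bar{\vec x})\wedge\bar{\vec x}_\alpha|+\mathcal{O}(\epsilon^2)$ and $d^{s}=\epsilon M^{s}/|\vec f(\bar{\vec x})\wedge\bar{\vec x}_\alpha|+\mathcal{O}(\epsilon^2)$, where $M^u$ is the integral defining $M$ with $\tau$ restricted to $(-\infty,p]$, and $M^s$ is minus the same integral with $\tau$ restricted to $[p,\infty)$, so $M=M^u-M^s$. Strip, pseudo-separatrix, flux. For fixed $p$ and $t$, the strip is $$S(p,\epsilon,t)=\left\{\vec r(s,\alpha)=\bar{\vec x}(p,\alpha)+\hat{\vec n}(p,\alpha)\left[s\,d^u(p,\alpha,\epsilon,t)+(1-s)\,d^s(p,\alpha,\epsilon,t)\right]:\alpha\in\mathrm{S}^1,\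 s\in[0,1]\right\}.$$ The pseudo-separatrix $\tilde\Gamma(p,t,\epsilon)$ is the closed surface formed by the union of: the part of $\Gamma^u_\epsilon(\vec a_\epsilon,t)$ emanating from $\vec a_\epsilon(t)$ until it first hits the strip; the strip $S(p,\epsilon,t)$; and the part of $\Gamma^s_\epsilon(\vec b_\epsilon,t)$ emanating from $\vec b_\epsilon(t)$ until it first hits the strip. The flux is Lagrangian: the stable and unstable manifold parts are material (invariant) surfaces moving with the flow and have no flux across them, so $\Phi$ is the flux of the velocity $\vec f+\epsilon\vec g(\cdot,t)$ across the strip, $\Phi(p,t,\epsilon)=\iint_S[\vec f+\epsilon\vec g]\cdot\mathrm{d}\vec S$, with vector surface element $\mathrm{d}\vec S=\vec r_\alpha\wedge\vec r_s\,\mathrm{d}s\,\mathrm{d}\alpha$ (oriented so that where the unstable manifold is outside the stable one the flux counts as outward, hence positive, and where it is inside the flux counts as inward, hence negative). *)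

theory Defs
  imports "HOL-Analysis.Analysis" "HOL-Library.Landau_Symbols"
begin

unbundle cross3_syntax

section \<open>Smoothness, divergence and spectra\<close>

definition C2_on :: "'a::real_normed_vector set \<Rightarrow> ('a \<Rightarrow> 'b::real_normed_vector) \<Rightarrow> bool" where
  "C2_on S f \<longleftrightarrow>
     (\<exists>(f' :: 'a \<Rightarrow> 'a \<Rightarrow>\<^sub>L 'b) (f'' :: 'a \<Rightarrow> 'a \<Rightarrow>\<^sub>L ('a \<Rightarrow>\<^sub>L 'b)).
        (\<forall>x\<in>S. (f has_derivative blinfun_apply (f' x)) (at x) \<and>
               (f' has_derivative blinfun_apply (f'' x)) (at x)) \<and>
        continuous_on S f'')"

definition divergence :: "(real^3 \<Rightarrow> real^3) \<Rightarrow> real^3 \<Rightarrow> real" where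
  "divergence f x = trace (jacobian f (at x))"

definition complex_mat :: "real^3^3 \<Rightarrow> complex^3^3" where
  "complex_mat A = (\<chi> i j. complex_of_real (A $ i $ j))"

definition complex_vec :: "real^3 \<Rightarrow> complex^3" where
  "complex_vec x = (\<chi> i. complex_of_real (x $ i))"

text \<open>One real eigenvalue in \<open>L\<close>, two (possibly equal or complex conjugate) eigenvalues in \<open>Z\<close>, the
  latter with linearly independent eigenvectors.\<close>

definition splits_one_two :: "real^3^3 \<Rightarrow> real set \<Rightarrow> complex set \<Rightarrow> bool" where
  "splits_one_two A L Z \<longleftrightarrow>
     (\<exists>l\<in>L. \<exists>v. v \<noteq> 0 \<and> A *v v = l *s v) \<and>
     (\<exists>\<mu>1\<in>Z. \<exists>\<mu>2\<in>Z. \<exists>w1 w2.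
        complex_mat A *v w1 = \<mu>1 *s w1 \<and> complex_mat A *v w2 = \<mu>2 *s w2 \<and>
        w1 \<noteq> w2 \<and> vec.independent {w1, w2})"

text \<open>The real part of the complex span of the eigenvectors with eigenvalue in \<open>Z\<close>.  With independent
  eigenvectors, as above, generalised eigenvectors need not be considered.\<close>

definition eigen_subspace :: "real^3^3 \<Rightarrow> complex set \<Rightarrow> (real^3) set" where
  "eigen_subspace A Z =
     {x. complex_vec x \<in> vec.span {w. \<exists>\<mu>\<in>Z. complex_mat A *v w = \<mu> *s w}}"

section \<open>Surfaces\<close>

definition C2_surface :: "(real^3) set \<Rightarrow> bool" where
  "C2_surface S \<longleftrightarrow>
     (\<forall>x\<in>S. \<exists>U (h :: real^3 \<Rightarrow> real). open U \<and> x \<in> U \<and> C2_on U h \<and>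
        (\<forall>y\<in>U. frechet_derivative h (at y) \<noteq> (\<lambda>_. 0)) \<and> S \<inter> U = {y \<in> U. h y = 0})"

definition tangent_vectors :: "(real^3) set \<Rightarrow> real^3 \<Rightarrow> (real^3) set" where
  "tangent_vectors S x =
     {v. \<exists>c. c 0 = x \<and> (c has_vector_derivative v) (at 0) \<and> (\<forall>\<^sub>F s in nhds (0::real). c s \<in> S)}"

section \<open>Trajectories and invariant manifolds of nonautonomous fields\<close>

text \<open>Solutions on an interval \<open>T\<close>, in integrated form: no continuity of the field in time is assumed,
  only measurability.  Where the field is continuous these are the classical solutions.\<close>

definition solution_on ::
    "(real^3) set \<Rightarrow> (real^3 \<Rightarrow> real \<Rightarrow> real^3) \<Rightarrow> real set \<Rightarrow> (real \<Rightarrow> real^3) \<Rightarrow> bool" where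
  "solution_on \<Omega> v T x \<longleftrightarrow> x ` T \<subseteq> \<Omega> \<and>
     (\<forall>s\<in>T. \<forall>t\<in>T. s \<le> t \<longrightarrow> ((\<lambda>\<tau>. v (x \<tau>) \<tau>) has_integral (x t - x s)) {s..t})"

text \<open>\<open>X\<close> is a fundamental matrix of \<open>y' = A(t) y\<close>; the projection \<open>P\<close> selects the \<open>k\<close>-dimensional
  space of solutions decaying forwards in time.\<close>

definition exponential_dichotomy :: "(real \<Rightarrow> real^3^3) \<Rightarrow> nat \<Rightarrow> bool" where
  "exponential_dichotomy A k \<longleftrightarrow>
     (\<exists>(X :: real \<Rightarrow> real^3^3) (P :: real^3^3) (K :: real) (\<beta> :: real).
        (\<forall>t. invertible (X t)) \<and>
        (\<forall>s t. s \<le> t \<longrightarrow> ((\<lambda>\<tau>. A \<tau> ** X \<tau>) has_integral (X t - X s)) {s..t}) \<and>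
        P ** P = P \<and> rank P = k \<and> K > 0 \<and> \<beta> > 0 \<and>
        (\<forall>s t. s \<le> t \<longrightarrow> norm (X t ** P ** matrix_inv (X s)) \<le> K * exp (- \<beta> * (t - s))) \<and>
        (\<forall>s t. s \<le> t \<longrightarrow>
           norm (X s ** (mat 1 - P) ** matrix_inv (X t)) \<le> K * exp (- \<beta> * (t - s))))"

definition hyperbolic_trajectory ::
    "(real^3) set \<Rightarrow> (real^3 \<Rightarrow> real \<Rightarrow> real^3) \<Rightarrow> nat \<Rightarrow> (real \<Rightarrow> real^3) \<Rightarrow> bool" where
  "hyperbolic_trajectory \<Omega> v k x \<longleftrightarrow> solution_on \<Omega> v UNIV x \<and>
     exponential_dichotomy (\<lambda>t. jacobian (\<lambda>y. v y t) (at (x t))) k"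

text \<open>Time slices at \<open>t\<close> of the unstable and stable manifolds of a trajectory \<open>x0\<close>.\<close>

definition unstable_manifold ::
    "(real^3) set \<Rightarrow> (real^3 \<Rightarrow> real \<Rightarrow> real^3) \<Rightarrow> (real \<Rightarrow> real^3) \<Rightarrow> real \<Rightarrow> (real^3) set" where
  "unstable_manifold \<Omega> v x0 t =
     {y. \<exists>x. solution_on \<Omega> v {..t} x \<and> x t = y \<and> ((\<lambda>s. x s - x0 s) \<longlongrightarrow> 0) at_bot}"

definition stable_manifold ::
    "(real^3) set \<Rightarrow> (real^3 \<Rightarrow> real \<Rightarrow> real^3) \<Rightarrow> (real \<Rightarrow> real^3) \<Rightarrow> real \<Rightarrow> (real^3) set" where
  "stable_manifold \<Omega> v x0 t =
     {y. \<exists>x. solution_on \<Omega> v {t..} x \<and> x t = y \<and> ((\<lambda>s. x s - x0 s) \<longlongrightarrow> 0) at_top}"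

section \<open>The unperturbed heteroclinic manifold\<close>

definition param_alpha :: "(real \<Rightarrow> real \<Rightarrow> real^3) \<Rightarrow> real \<Rightarrow> real \<Rightarrow> real^3" where
  "param_alpha xbar p \<alpha> = vector_derivative (xbar p) (at \<alpha>)"

definition normal_vec ::
    "(real^3 \<Rightarrow> real^3) \<Rightarrow> (real \<Rightarrow> real \<Rightarrow> real^3) \<Rightarrow> real \<Rightarrow> real \<Rightarrow> real^3" where
  "normal_vec f xbar p \<alpha> = f (xbar p \<alpha>) \<times> param_alpha xbar p \<alpha>"

definition unit_normal ::
    "(real^3 \<Rightarrow> real^3) \<Rightarrow> (real \<Rightarrow> real \<Rightarrow> real^3) \<Rightarrow> real \<Rightarrow> real \<Rightarrow> real^3" where
  "unit_normal f xbar p \<alpha> = sgn (normal_vec f xbar p \<alpha>)"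

definition param_surface :: "(real \<Rightarrow> real \<Rightarrow> real^3) \<Rightarrow> (real^3) set" where
  "param_surface xbar = {xbar p \<alpha> | p \<alpha>. True}"

text \<open>The circle of labels \<open>\<alpha>\<close> is represented by 1-periodicity.  The set-theoretic (un)stable manifolds
  contain the fixed points.  Their tangency to the spectral subspaces, part of what the invariant
  manifold theorem says about them, is recorded explicitly.\<close>

locale heteroclinic_system =
  fixes \<Omega> :: "(real^3) set"
    and f :: "real^3 \<Rightarrow> real^3"
    and g :: "real^3 \<Rightarrow> real \<Rightarrow> real^3"
    and a b :: "real^3"
    and xbar :: "real \<Rightarrow> real \<Rightarrow> real^3"
  assumes open_domain: "open \<Omega>"
    and f_C2: "C2_on \<Omega> f"
    and Df_bounded: "\<exists>K. \<forall>x\<in>\<Omega>. norm (jacobian f (at x)) \<le> K"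
    and g_C2: "\<And>t. C2_on \<Omega> (\<lambda>x. g x t)"
    and g_bounded: "\<exists>K. \<forall>x\<in>\<Omega>. \<forall>t. norm (g x t) \<le> K"
    and Dg_bounded: "\<exists>K. \<forall>x\<in>\<Omega>. \<forall>t. norm (jacobian (\<lambda>y. g y t) (at x)) \<le> K"
    and g_measurable: "\<And>x. x \<in> \<Omega> \<Longrightarrow> g x \<in> borel_measurable borel"
    and fixed_points: "a \<in> \<Omega>" "b \<in> \<Omega>" "a \<noteq> b" "f a = 0" "f b = 0"
    and spectrum_a: "splits_one_two (jacobian f (at a)) {..<0} {\<mu>. Re \<mu> > 0}"
    and spectrum_b: "splits_one_two (jacobian f (at b)) {0<..} {\<mu>. Re \<mu> < 0}"
    and unstable_eq: "unstable_manifold \<Omega> (\<lambda>x _. f x) (\<lambda>_. a) 0 = insert a (param_surface xbar)"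
    and stable_eq: "stable_manifold \<Omega> (\<lambda>x _. f x) (\<lambda>_. b) 0 = insert b (param_surface xbar)"
    and end_points: "a \<notin> param_surface xbar" "b \<notin> param_surface xbar"
    and unstable_smooth: "C2_surface (insert a (param_surface xbar))"
    and stable_smooth: "C2_surface (insert b (param_surface xbar))"
    and unstable_tangent: "tangent_vectors (insert a (param_surface xbar)) a =
          eigen_subspace (jacobian f (at a)) {\<mu>. Re \<mu> > 0}"
    and stable_tangent: "tangent_vectors (insert b (param_surface xbar)) b =
          eigen_subspace (jacobian f (at b)) {\<mu>. Re \<mu> < 0}"
    and closed_surface: "compact (param_surface xbar \<union> {a, b})"
    and separates: "inside (param_surface xbar \<union> {a, b}) \<noteq> {}"
          "connected (inside (param_surface xbar \<union> {a, b}))"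
          "connected (outside (param_surface xbar \<union> {a, b}))"
    and param_C2: "C2_on UNIV (\<lambda>(p, \<alpha>). xbar p \<alpha>)"
    and param_periodic: "\<And>p \<alpha>. xbar p (\<alpha> + 1) = xbar p \<alpha>"
    and param_inj: "\<And>p q \<alpha> \<beta>. xbar p \<alpha> = xbar q \<beta> \<Longrightarrow> p = q \<and> \<alpha> - \<beta> \<in> \<int>"
    and param_flow: "\<And>p \<alpha>. ((\<lambda>q. xbar q \<alpha>) has_vector_derivative f (xbar p \<alpha>)) (at p)"
    and param_lim_a: "\<And>\<alpha>. ((\<lambda>p. xbar p \<alpha>) \<longlongrightarrow> a) at_bot"
    and param_lim_b: "\<And>\<alpha>. ((\<lambda>p. xbar p \<alpha>) \<longlongrightarrow> b) at_top"
    and normal_nonzero: "\<And>p \<alpha>. normal_vec f xbar p \<alpha> \<noteq> 0"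
    and normal_outward: "\<And>p \<alpha>. \<forall>\<^sub>F s in at_right 0.
          xbar p \<alpha> + s *\<^sub>R unit_normal f xbar p \<alpha> \<in> outside (param_surface xbar \<union> {a, b})"

section \<open>Melnikov functions\<close>

definition melnikov_integrand ::
    "(real^3 \<Rightarrow> real^3) \<Rightarrow> (real^3 \<Rightarrow> real \<Rightarrow> real^3) \<Rightarrow> (real \<Rightarrow> real \<Rightarrow> real^3) \<Rightarrow>
     real \<Rightarrow> real \<Rightarrow> real \<Rightarrow> real \<Rightarrow> real" where
  "melnikov_integrand f g xbar p \<alpha> t \<tau> =
     exp (LBINT \<xi>=ereal \<tau>..ereal p. divergence f (xbar \<xi> \<alpha>)) *
     (normal_vec f xbar \<tau> \<alpha> \<bullet> g (xbar \<tau> \<alpha>) (\<tau> + t - p))"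

definition melnikov where
  "melnikov f g xbar p \<alpha> t = (LINT \<tau>|lborel. melnikov_integrand f g xbar p \<alpha> t \<tau>)"

definition melnikov_u where
  "melnikov_u f g xbar p \<alpha> t = (LINT \<tau>:{..p}|lborel. melnikov_integrand f g xbar p \<alpha> t \<tau>)"

definition melnikov_s where
  "melnikov_s f g xbar p \<alpha> t = - (LINT \<tau>:{p..}|lborel. melnikov_integrand f g xbar p \<alpha> t \<tau>)"

section \<open>Perturbed manifolds, pseudo-separatrix and flux\<close>

definition perturbed_field ::
    "(real^3 \<Rightarrow> real^3) \<Rightarrow> (real^3 \<Rightarrow> real \<Rightarrow> real^3) \<Rightarrow> real \<Rightarrow> real^3 \<Rightarrow> real \<Rightarrow> real^3" where
  "perturbed_field f g \<epsilon> x t = f x + \<epsilon> *\<^sub>R g x t"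

text \<open>\<open>d \<alpha> \<epsilon>\<close> is the signed distance, along the unit normal at \<open>xbar p \<alpha>\<close>, to a nearby point of the
  surface \<open>W \<epsilon>\<close>.  As that surface may meet the normal line again far along the manifold, \<open>d\<close> is a
  differentiable choice tending to 0 and not a function of \<open>W \<epsilon>\<close> as a set.\<close>

definition signed_normal_distance ::
    "(real^3 \<Rightarrow> real^3) \<Rightarrow> (real \<Rightarrow> real \<Rightarrow> real^3) \<Rightarrow> real \<Rightarrow> (real \<Rightarrow> (real^3) set) \<Rightarrow>
     (real \<Rightarrow> real \<Rightarrow> real) \<Rightarrow> bool" where
  "signed_normal_distance f xbar p W d \<longleftrightarrow>
     (\<forall>\<^sub>F \<epsilon> in at_right 0. \<forall>\<alpha>.
        xbar p \<alpha> + d \<alpha> \<epsilon> *\<^sub>R unit_normal f xbar p \<alpha> \<in> W \<epsilon> \<and>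
        d (\<alpha> + 1) \<epsilon> = d \<alpha> \<epsilon> \<and> (\<lambda>\<beta>. d \<beta> \<epsilon>) differentiable (at \<alpha>)) \<and>
     uniform_limit UNIV (\<lambda>\<epsilon> \<alpha>. d \<alpha> \<epsilon>) (\<lambda>_. 0) (at_right 0)"

definition strip_chart ::
    "(real^3 \<Rightarrow> real^3) \<Rightarrow> (real \<Rightarrow> real \<Rightarrow> real^3) \<Rightarrow>
     (real \<Rightarrow> real \<Rightarrow> real \<Rightarrow> real \<Rightarrow> real) \<Rightarrow> (real \<Rightarrow> real \<Rightarrow> real \<Rightarrow> real \<Rightarrow> real) \<Rightarrow>
     real \<Rightarrow> real \<Rightarrow> real \<Rightarrow> real \<Rightarrow> real \<Rightarrow> real^3" where
  "strip_chart f xbar du ds p \<epsilon> t s \<alpha> =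
     xbar p \<alpha> + (s * du p \<alpha> \<epsilon> t + (1 - s) * ds p \<alpha> \<epsilon> t) *\<^sub>R unit_normal f xbar p \<alpha>"

definition chart_image :: "(real \<Rightarrow> real \<Rightarrow> real^3) \<Rightarrow> (real^3) set" where
  "chart_image r = {r s \<alpha> | s \<alpha>. s \<in> {0..1} \<and> \<alpha> \<in> {0..<1}}"

record pseudo_separatrix =
  unstable_part :: "(real^3) set"
  stable_part :: "(real^3) set"
  strip :: "real \<Rightarrow> real \<Rightarrow> real^3"

definition pseudo_separatrix_surface :: "pseudo_separatrix \<Rightarrow> (real^3) set" where
  "pseudo_separatrix_surface \<Sigma> = unstable_part \<Sigma> \<union> chart_image (strip \<Sigma>) \<union> stable_part \<Sigma>"

text \<open>The part of a manifold emanating from a point until it hits the strip: what can be reached from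
  the point along the manifold without meeting the strip (the bounding curve lies in the strip).\<close>

definition pseudo_separatrix_of ::
    "(real^3) set \<Rightarrow> real^3 \<Rightarrow> (real^3) set \<Rightarrow> real^3 \<Rightarrow> (real \<Rightarrow> real \<Rightarrow> real^3) \<Rightarrow>
     pseudo_separatrix" where
  "pseudo_separatrix_of Wu a Ws b r =
     \<lparr>unstable_part = path_component_set (Wu - chart_image r) a,
      stable_part = path_component_set (Ws - chart_image r) b,
      strip = r\<rparr>"

text \<open>The flux is Lagrangian: the unstable and stable parts move with the fluid and nothing crosses
  them, so that only the strip contributes.\<close>

definition lagrangian_flux :: "(real^3 \<Rightarrow> real^3) \<Rightarrow> pseudo_separatrix \<Rightarrow> real" where
  "lagrangian_flux v \<Sigma> =
     (LBINT \<alpha>=0..1. (LBINT s=0..1.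
        v (strip \<Sigma> s \<alpha>) \<bullet>
        (vector_derivative (\<lambda>\<beta>. strip \<Sigma> s \<beta>) (at \<alpha>) \<times>
         vector_derivative (\<lambda>\<sigma>. strip \<Sigma> \<sigma> \<alpha>) (at s))))"

end

theory Submission
  imports Defs
begin

text \<open>
  On the strip \<open>r = xbar + h n\<close> with \<open>h = s d\<^sup>u + (1 - s) d\<^sup>s\<close> one has \<open>r\<^sub>s = (d\<^sup>u - d\<^sup>s) n\<close>, so in
  \<open>r\<^sub>\<alpha> \<and> r\<^sub>s\<close> the derivatives of \<open>d\<^sup>u\<close> and \<open>d\<^sup>s\<close> drop out, and the flux density is
  \<open>(d\<^sup>u - d\<^sup>s) (|f \<and> xbar\<^sub>\<alpha>| + O(\<epsilon>)) = \<epsilon> (M\<^sup>u - M\<^sup>s) + O(\<epsilon>\<^sup>2)\<close>.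

  The identity \<open>M = M\<^sup>u - M\<^sup>s\<close> requires the Melnikov integrand to be Lebesgue integrable.  The normal
  weighted by the exponential of the integrated divergence solves the adjoint variational equation
  \<open>w' = - Df\<^sup>T w\<close>.  Its direction is that of the gradient of a local defining function of the
  \<open>C\<^sup>2\<close> surface \<open>\<Gamma>\<close>, hence converges at each end to the normal of the two-dimensional spectral
  subspace.  That normal is a left eigenvector for the remaining real eigenvalue, and the sign of this
  eigenvalue forces \<open>w\<close> to decay exponentially.
\<close>

section \<open>Linear algebra\<close>

text \<open>Linearization at the identity of
  \<open>(M u) \<times> (M v) = cof M (u \<times> v)\<close>: the derivative of the cofactor matrix
  in direction \<open>A\<close> is \<open>trace A\<close> times the identity minus
  \<open>transpose A\<close>. It converts the product rule for the normal into a linear differential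
  equation for the normal itself.\<close>

lemma cross_trace:
  fixes A :: "real^3^3"
  shows "(A *v u) \<times> v + u \<times> (A *v v) = trace A *\<^sub>R (u \<times> v) - transpose A *v (u \<times> v)"
  by (simp add: vec_eq_iff forall_3 cross_components matrix_vector_mult_def transpose_def trace_def
      sum_3 algebra_simps)

text \<open>Matrices carry the Frobenius norm here, so the bound is Cauchy-Schwarz applied row by
  row.\<close>

lemma matrix_vector_norm_le:
  fixes A :: "real^'n^'m"
  shows "norm (A *v x) \<le> norm A * norm x"
proof -
  have "norm (A *v x) = L2_set (\<lambda>i. (A $ i) \<bullet> x) UNIV"
    unfolding norm_vec_def[of "A *v x"]
    by (simp add: matrix_vector_mul_component L2_set_def)
  also have "\<dots> \<le> L2_set (\<lambda>i. norm (A $ i) * norm x) UNIV"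
    unfolding L2_set_def
    by (intro real_sqrt_le_mono sum_mono) (metis Cauchy_Schwarz_ineq2 power2_abs power_mono abs_ge_zero)
  also have "\<dots> = norm A * norm x"
    unfolding norm_vec_def[of A] by (subst L2_set_left_distrib) auto
  finally show ?thesis .
qed

section \<open>Complex eigenvectors of real matrices and left eigenvectors\<close>

lemma complex_vec_nth [simp]: "complex_vec x $ i = complex_of_real (x $ i)"
  by (simp add: complex_vec_def)

lemma complex_mat_vec: "complex_mat A *v complex_vec x = complex_vec (A *v x)"
  by (simp add: vec_eq_iff complex_mat_def matrix_vector_mult_def)

definition vec_Re :: "complex^3 \<Rightarrow> real^3" where "vec_Re w = (\<chi> i. Re (w $ i))"
definition vec_Im :: "complex^3 \<Rightarrow> real^3" where "vec_Im w = (\<chi> i. Im (w $ i))"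

text \<open>Since \<open>A\<close> is real, the conjugate \<open>w'\<close> of \<open>w\<close> is
  an eigenvector for \<open>cnj \<mu>\<close>, and the real and imaginary parts of \<open>w\<close>
  are complex combinations of \<open>w\<close> and \<open>w'\<close>.\<close>

lemma eigen_subspace_Re_Im:
  assumes ev: "complex_mat A *v w = \<mu> *s w" and \<mu>: "\<mu> \<in> Z" and cnj: "cnj \<mu> \<in> Z"
  shows "vec_Re w \<in> eigen_subspace A Z" "vec_Im w \<in> eigen_subspace A Z"
proof -
  define w' where "w' = (\<chi> i. cnj (w $ i))"
  let ?E = "{w. \<exists>\<mu>\<in>Z. complex_mat A *v w = \<mu> *s w}"
  have w: "w \<in> ?E" using ev \<mu> by auto
  have "complex_mat A *v w' = cnj \<mu> *s w'"
  proof -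
    have "(complex_mat A *v w') $ i = cnj ((complex_mat A *v w) $ i)" for i
      by (simp add: matrix_vector_mult_def complex_mat_def w'_def)
    then show ?thesis by (simp add: vec_eq_iff ev w'_def)
  qed
  then have w': "w' \<in> ?E" using cnj by auto
  have "complex_vec (vec_Re w) = (1/2) *s w + (1/2) *s w'"
    by (simp add: vec_eq_iff vec_Re_def w'_def complex_eq_iff)
  moreover have "(1/2) *s w + (1/2) *s w' \<in> vec.span ?E"
    by (intro vec.span_add vec.span_scale vec.span_base w w')
  ultimately show "vec_Re w \<in> eigen_subspace A Z" unfolding eigen_subspace_def by simp
  have "complex_vec (vec_Im w) = (-\<i>/2) *s w + (\<i>/2) *s w'"
    by (simp add: vec_eq_iff vec_Im_def w'_def complex_eq_iff)
  moreover have "(-\<i>/2) *s w + (\<i>/2) *s w' \<in> vec.span ?E"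
    by (intro vec.span_add vec.span_scale vec.span_base w w')
  ultimately show "vec_Im w \<in> eigen_subspace A Z" unfolding eigen_subspace_def by simp
qed

text \<open>Bilinear on purpose: without conjugation it is complex linear in \<open>w\<close>, so it
  vanishes on spans and lets a real matrix pass to the other side as its transpose.\<close>

definition cdot :: "real^3 \<Rightarrow> complex^3 \<Rightarrow> complex" where
  "cdot u w = (\<Sum>i\<in>UNIV. complex_of_real (u $ i) * w $ i)"

lemma cdot_scale: "cdot u (c *s w) = c * cdot u w"
  by (simp add: cdot_def sum_distrib_left mult_ac)

lemma cdot_complex_vec: "cdot u (complex_vec x) = complex_of_real (u \<bullet> x)"
  by (simp add: cdot_def inner_vec_def)

lemma cdot_transpose: "cdot (transpose A *v u) w = cdot u (complex_mat A *v w)"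
  by (simp add: cdot_def sum_3 transpose_def matrix_vector_mult_def complex_mat_def algebra_simps)

lemma cdot_diff_left: "cdot (u - v) w = cdot u w - cdot v w"
  by (simp add: cdot_def sum_3 algebra_simps)

lemma cdot_scaleR_left: "cdot (r *\<^sub>R u) w = complex_of_real r * cdot u w"
  by (simp add: cdot_def sum_3 algebra_simps)

lemma cdot_span_zero:
  assumes "\<And>w. w \<in> S \<Longrightarrow> cdot u w = 0" "w \<in> vec.span S"
  shows "cdot u w = 0"
  using assms(2)
proof (induction rule: vec.span_induct)
  case base
  show ?case
    by (auto simp: vec.subspace_def cdot_def sum_3 algebra_simps)
       (metis (no_types, lifting) distrib_left mult_zero_right add.assoc)
next
  case (step x) then show ?case using assms by auto
qed

lemma cdot_eq_zero_UNIV: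
  assumes "\<And>w. cdot u w = 0" shows "u = 0"
proof -
  have "complex_of_real (u \<bullet> u) = 0" using assms cdot_complex_vec by metis
  then show ?thesis by simp
qed

text \<open>The functional \<open>cdot \<nu>\<close> kills both eigenvectors with eigenvalue in
  \<open>Z\<close>, because it kills their real and imaginary parts. Together with the real
  eigenvector \<open>v\<close> they form a basis of complex 3-space. The vector
  \<open>transpose A *v \<nu> - l *\<^sub>R \<nu>\<close> pairs to zero with \<open>w1\<close> and
  \<open>w2\<close>, where \<open>\<nu>\<close> already vanishes, and with \<open>v\<close>, where
  both terms give \<open>l\<close> times the same number; hence it is zero.\<close>

lemma left_eigenvector:
  assumes split: "splits_one_two A L Z"
    and cnj: "\<And>\<mu>. \<mu> \<in> Z \<Longrightarrow> cnj \<mu> \<in> Z"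
    and disj: "\<And>l. l \<in> L \<Longrightarrow> complex_of_real l \<notin> Z"
    and orth: "\<And>v. v \<in> eigen_subspace A Z \<Longrightarrow> \<nu> \<bullet> v = 0"
    and nz: "\<nu> \<noteq> 0"
  shows "\<exists>l\<in>L. transpose A *v \<nu> = l *\<^sub>R \<nu>"
proof -
  obtain l v where l: "l \<in> L" "v \<noteq> 0" "A *v v = l *s v"
    using split unfolding splits_one_two_def by blast
  obtain \<mu>1 \<mu>2 w1 w2 where w: "\<mu>1 \<in> Z" "\<mu>2 \<in> Z"
      "complex_mat A *v w1 = \<mu>1 *s w1" "complex_mat A *v w2 = \<mu>2 *s w2"
      "w1 \<noteq> w2" "vec.independent {w1, w2}"
    using split unfolding splits_one_two_def by blast
  have cdot0: "cdot \<nu> w = 0" if "complex_mat A *v w = \<mu> *s w" "\<mu> \<in> Z" for w \<mu>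
  proof -
    have "\<nu> \<bullet> vec_Re w = 0" "\<nu> \<bullet> vec_Im w = 0"
      using eigen_subspace_Re_Im[OF that cnj[OF that(2)]] orth by auto
    then show ?thesis
      by (simp add: complex_eq_iff cdot_def vec_Re_def vec_Im_def inner_vec_def)
  qed
  let ?v = "complex_vec v"
  have v0: "?v \<noteq> 0" using l(2) by (simp add: vec_eq_iff)
  have Av: "complex_mat A *v ?v = of_real l *s ?v"
    using l(3) by (simp add: complex_mat_vec vec_eq_iff)
  have notin: "?v \<notin> vec.span {w1, w2}"
  proof
    assume "?v \<in> vec.span {w1, w2}"
    then obtain c1 c2 where c: "?v = c1 *s w1 + c2 *s w2"
      by (auto simp: vec.span_breakdown_eq algebra_simps)
    have "complex_mat A *v ?v = (c1 * \<mu>1) *s w1 + (c2 * \<mu>2) *s w2"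
      unfolding c by (simp add: matrix_vector_right_distrib vector_scalar_commute w)
    then have "(c1 * \<mu>1) *s w1 + (c2 * \<mu>2) *s w2 = of_real l *s (c1 *s w1 + c2 *s w2)"
      using Av c by simp
    \<comment> \<open>As \<open>l\<close> is outside \<open>Z\<close>, the factors
      \<open>\<mu>1 - l\<close> and \<open>\<mu>2 - l\<close> are nonzero, so independence of
      \<open>w1\<close> and \<open>w2\<close> forces \<open>c1 = c2 = 0\<close>.\<close>
    then have rel: "(c1 * (\<mu>1 - of_real l)) *s w1 + (c2 * (\<mu>2 - of_real l)) *s w2 = 0"
      by (simp add: vec_eq_iff algebra_simps)
    have "x1 = 0 \<and> x2 = 0" if "x1 *s w1 + x2 *s w2 = 0" for x1 x2
    proof -
      have "(\<Sum>z\<in>{w1,w2}. (if z = w1 then x1 else x2) *s z) = 0"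
        using that w(5) by simp
      from vec.independentD[OF w(6) _ subset_refl this] show ?thesis
        using w(5) by (metis finite.intros insert_iff)
    qed
    from this[OF rel] have "c1 = 0" "c2 = 0"
      using disj[OF l(1)] w(1,2) by auto
    then show False using v0 c by simp
  qed
  have ind: "vec.independent {?v, w1, w2}"
    using notin w(6) by (rule vec.independent_insertI)
  have "card {?v, w1, w2} = 3"
    using notin w(5) by (metis card_3_iff insertCI vec.span_base)
  then have span: "vec.span {?v, w1, w2} = UNIV"
    using vec.card_eq_dim[of "{?v,w1,w2}" UNIV] ind by (simp add: card_cart_basis top.extremum_unique)
  have \<nu>v: "cdot \<nu> ?v \<noteq> 0"
  proof
    assume "cdot \<nu> ?v = 0"
    then have "cdot \<nu> w = 0" for w
      using cdot_span_zero[of "{?v, w1, w2}" \<nu> w] span cdot0[OF w(3,1)] cdot0[OF w(4,2)] by auto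
    then show False using cdot_eq_zero_UNIV nz by blast
  qed
  let ?u = "transpose A *v \<nu> - l *\<^sub>R \<nu>"
  have "cdot ?u w = 0" if "w \<in> {?v, w1, w2}" for w
    using that Av w(3,4) cdot0[OF w(3,1)] cdot0[OF w(4,2)]
    by (auto simp: cdot_diff_left cdot_scaleR_left cdot_transpose cdot_scale
        simp del: transpose_matrix_vector)
  then have "cdot ?u w = 0" for w
    using cdot_span_zero[of "{?v, w1, w2}" ?u w] span by blast
  then have "?u = 0"
    by (rule cdot_eq_zero_UNIV)
  then show ?thesis using l(1) by (metis eq_iff_diff_eq_0)
qed

section \<open>Differentiability along the heteroclinic manifold\<close>

interpretation cross3: bounded_bilinear cross3
  using bilinear_cross bilinear_conv_bounded_bilinear by blast

lemma bounded_bilinear_matrix_vector: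
  "bounded_bilinear (\<lambda>(A :: real^'n^'m) x. A *v x)"
  by (rule bounded_bilinear.intro)
     (auto simp: matrix_vector_mult_add_rdistrib matrix_vector_right_distrib matrix_vector_mult_scaleR
        scaleR_matrix_vector_assoc intro!: exI[of _ 1] matrix_vector_norm_le)

interpretation matrix_vector: bounded_bilinear "\<lambda>(A :: real^'n^'m) x. A *v x"
  by (rule bounded_bilinear_matrix_vector)

lemma C2_on_has_derivative_jacobian:
  fixes f :: "real^'n \<Rightarrow> real^'m"
  assumes "C2_on S f" "x \<in> S"
  shows "(f has_derivative (\<lambda>h. jacobian f (at x) *v h)) (at x)"
  using assms unfolding C2_on_def
  by (metis differentiableI jacobian_works)

lemma has_derivative_imp_continuous_on:
  "(\<And>x. x \<in> S \<Longrightarrow> (f has_derivative f' x) (at x)) \<Longrightarrow> continuous_on S f"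
  using has_derivative_continuous continuous_at_imp_continuous_on by blast

lemma C2_on_continuous_jacobian:
  fixes f :: "real^'n \<Rightarrow> real^'m"
  assumes "C2_on S f"
  shows "continuous_on S (\<lambda>x. jacobian f (at x))"
proof -
  obtain f' f'' where f': "\<And>x. x \<in> S \<Longrightarrow> (f has_derivative blinfun_apply (f' x)) (at x)"
      and f'': "\<And>x. x \<in> S \<Longrightarrow> (f' has_derivative blinfun_apply (f'' x)) (at x)"
    using assms unfolding C2_on_def by blast
  have "continuous_on S f'"
    using f'' by (rule has_derivative_imp_continuous_on)
  then have "continuous_on S (\<lambda>x. \<chi> i j. f' x (axis j 1) $ i)"
    by (intro continuous_on_vec_lambda continuous_intros)
  moreover have "jacobian f (at x) = (\<chi> i j. f' x (axis j 1) $ i)" if "x \<in> S" for x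
    using frechet_derivative_at[OF f'[OF that]] by (simp add: jacobian_def matrix_def)
  ultimately show ?thesis by (simp cong: continuous_on_cong)
qed

lemma C2_on_imp_continuous_on: "C2_on S f \<Longrightarrow> continuous_on S f"
  unfolding C2_on_def by (metis continuous_at_imp_continuous_on has_derivative_continuous)

lemma blinfun_apply_Pair_zero:
  fixes T :: "(real \<times> real) \<Rightarrow>\<^sub>L 'b::real_normed_vector"
  shows "h *\<^sub>R blinfun_apply T (0, 1) = blinfun_apply T (0, h)"
  by (simp flip: blinfun.scaleR_right)

section \<open>Regularity of the parametrization and the variational equation\<close>

context heteroclinic_system
begin

abbreviation J :: "real^3 \<Rightarrow> real^3^3" where "J x \<equiv> jacobian f (at x)"
abbreviation x\<^sub>\<alpha> :: "real \<Rightarrow> real \<Rightarrow> real^3" where "x\<^sub>\<alpha> \<equiv> param_alpha xbar"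
abbreviation N :: "real \<Rightarrow> real \<Rightarrow> real^3" where "N \<equiv> normal_vec f xbar"

text \<open>Read off from \<open>unstable_eq\<close>: every point of the unstable manifold is the
  end of a solution that stays in \<open>\<Omega>\<close>.\<close>

lemma xbar_in_domain: "xbar p \<alpha> \<in> \<Omega>"
proof -
  have "xbar p \<alpha> \<in> unstable_manifold \<Omega> (\<lambda>x _. f x) (\<lambda>_. a) 0"
    unfolding unstable_eq param_surface_def by auto
  then show ?thesis
    unfolding unstable_manifold_def solution_on_def by force
qed

lemma f_has_derivative: "x \<in> \<Omega> \<Longrightarrow> (f has_derivative (\<lambda>h. J x *v h)) (at x)"
  using f_C2 by (rule C2_on_has_derivative_jacobian)

lemma continuous_J: "continuous_on \<Omega> J"
  using f_C2 by (rule C2_on_continuous_jacobian)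

lemma continuous_f: "continuous_on \<Omega> f"
  using f_C2 by (rule C2_on_imp_continuous_on)

text \<open>The partial derivative is the total derivative \<open>F'\<close> applied to the fixed
  direction \<open>(0, 1)\<close>. Its continuity and its own \<alpha>-derivative are therefore
  inherited from \<open>F'\<close> and \<open>F''\<close>.\<close>

lemma param_alpha_C1:
  shows xbar_deriv_alpha: "(xbar p has_vector_derivative x\<^sub>\<alpha> p \<alpha>) (at \<alpha>)"
    and continuous_xbar: "continuous_on UNIV (\<lambda>(p, \<alpha>). xbar p \<alpha>)"
    and continuous_param_alpha: "continuous_on UNIV (\<lambda>(p, \<alpha>). x\<^sub>\<alpha> p \<alpha>)"
    and param_alpha_deriv_alpha:
      "\<exists>D. (\<forall>\<alpha>. (x\<^sub>\<alpha> p has_vector_derivative D \<alpha>) (at \<alpha>)) \<and> continuous_on UNIV D"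
proof -
  let ?F = "\<lambda>(p, \<alpha>). xbar p \<alpha>"
  obtain F' F'' where F': "\<And>x. (?F has_derivative blinfun_apply (F' x)) (at x)"
      and F'': "\<And>x. (F' has_derivative blinfun_apply (F'' x)) (at x)"
      and cont: "continuous_on UNIV F''"
    using param_C2 unfolding C2_on_def by auto
  have pair: "((\<lambda>\<beta>. (q, \<beta>)) has_derivative (\<lambda>h. (0, h))) (at \<beta>)" for q \<beta> :: real
    by (auto intro!: derivative_eq_intros)
  have deriv: "(xbar q has_vector_derivative F' (q, \<beta>) (0, 1)) (at \<beta>)" for q \<beta>
    using has_derivative_compose[OF pair F'[of "(q, \<beta>)"]]
    by (simp add: has_vector_derivative_def blinfun_apply_Pair_zero)
  then have xa: "x\<^sub>\<alpha> q \<beta> = F' (q, \<beta>) (0, 1)" for q \<beta>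
    unfolding param_alpha_def by (simp add: vector_derivative_at)
  show "(xbar p has_vector_derivative x\<^sub>\<alpha> p \<alpha>) (at \<alpha>)"
    using deriv xa by simp
  show "continuous_on UNIV ?F"
    using F' by (rule has_derivative_imp_continuous_on)
  have cF': "continuous_on UNIV F'"
    using F'' by (rule has_derivative_imp_continuous_on)
  then show "continuous_on UNIV (\<lambda>(p, \<alpha>). x\<^sub>\<alpha> p \<alpha>)"
    unfolding xa split_beta by (simp, intro continuous_intros)
  show "\<exists>D. (\<forall>\<alpha>. (x\<^sub>\<alpha> p has_vector_derivative D \<alpha>) (at \<alpha>)) \<and> continuous_on UNIV D"
  proof (intro exI[of _ "\<lambda>\<alpha>. F'' (p, \<alpha>) (0, 1) (0, 1)"] conjI allI)
    fix \<alpha>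
    have "((\<lambda>\<beta>. F' (p, \<beta>)) has_vector_derivative F'' (p, \<alpha>) (0, 1)) (at \<alpha>)"
      using has_derivative_compose[OF pair F''[of "(p, \<alpha>)"]]
      by (simp add: has_vector_derivative_def blinfun_apply_Pair_zero)
    from bounded_linear.has_vector_derivative[OF blinfun.bounded_linear_left this, of "(0, 1)"]
    show "(x\<^sub>\<alpha> p has_vector_derivative F'' (p, \<alpha>) (0, 1) (0, 1)) (at \<alpha>)"
      by (simp flip: xa)
    show "continuous_on UNIV (\<lambda>\<alpha>. F'' (p, \<alpha>) (0, 1) (0, 1))"
      by (intro continuous_intros continuous_on_compose2[OF cont]) auto
  qed
qed

lemma continuous_on_xbar [continuous_intros]:
  "continuous_on S u \<Longrightarrow> continuous_on S v \<Longrightarrow> continuous_on S (\<lambda>z. xbar (u z) (v z))"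
  using continuous_on_compose2[OF continuous_xbar, of S "\<lambda>z. (u z, v z)"] by (simp add: continuous_on_Pair)

lemma continuous_on_param_alpha [continuous_intros]:
  "continuous_on S u \<Longrightarrow> continuous_on S v \<Longrightarrow> continuous_on S (\<lambda>z. x\<^sub>\<alpha> (u z) (v z))"
  using continuous_on_compose2[OF continuous_param_alpha, of S "\<lambda>z. (u z, v z)"] by (simp add: continuous_on_Pair)

lemma continuous_on_f_xbar [continuous_intros]:
  "continuous_on S u \<Longrightarrow> continuous_on S v \<Longrightarrow> continuous_on S (\<lambda>z. f (xbar (u z) (v z)))"
  by (rule continuous_on_compose2[OF continuous_f]) (auto intro!: continuous_intros xbar_in_domain)

lemma continuous_on_J_xbar [continuous_intros]:
  "continuous_on S u \<Longrightarrow> continuous_on S v \<Longrightarrow> continuous_on S (\<lambda>z. J (xbar (u z) (v z)))"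
  by (rule continuous_on_compose2[OF continuous_J]) (auto intro!: continuous_intros xbar_in_domain)

lemma f_xbar_deriv:
  assumes "((\<lambda>s. xbar (u s) (v s)) has_vector_derivative D) (at s)"
  shows "((\<lambda>s. f (xbar (u s) (v s))) has_vector_derivative J (xbar (u s) (v s)) *v D) (at s)"
  using has_derivative_compose[OF assms[unfolded has_vector_derivative_def] f_has_derivative[OF xbar_in_domain]]
  by (simp add: has_vector_derivative_def matrix_vector.scaleR_right)

text \<open>Leibniz's rule under \<open>xbar q \<alpha> - xbar q0 \<alpha> = \<integral> f (xbar s \<alpha>) ds\<close> replaces the symmetry of the
  second derivative of \<open>xbar\<close>.\<close>

lemma variational_equation:
  "((\<lambda>q. x\<^sub>\<alpha> q \<alpha>) has_vector_derivative J (xbar p \<alpha>) *v x\<^sub>\<alpha> p \<alpha>) (at p)"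
proof -
  let ?V = "\<lambda>s \<beta>. J (xbar s \<beta>) *v x\<^sub>\<alpha> s \<beta>"
  \<comment> \<open>Any base point strictly left of \<open>p\<close> serves: \<open>eq\<close> holds
    only to the right of \<open>q0\<close>, and \<open>p\<close> must be interior to
    \<open>{q0..p + 1}\<close> for a two-sided derivative.\<close>
  define q0 where "q0 = p - 1"
  have eq: "x\<^sub>\<alpha> q \<alpha> = x\<^sub>\<alpha> q0 \<alpha> + integral {q0..q} (\<lambda>s. ?V s \<alpha>)" if "q0 \<le> q" for q
  proof -
    have int: "integral (cbox q0 q) (\<lambda>s. f (xbar s \<beta>)) = xbar q \<beta> - xbar q0 \<beta>" for \<beta>
      using fundamental_theorem_of_calculus[OF that, of "\<lambda>s. xbar s \<beta>" "\<lambda>s. f (xbar s \<beta>)"]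
      by (auto intro: has_vector_derivative_at_within param_flow integral_unique)
    have "((\<lambda>\<beta>. integral (cbox q0 q) (\<lambda>s. f (xbar s \<beta>))) has_vector_derivative
        integral (cbox q0 q) (\<lambda>s. ?V s \<alpha>)) (at \<alpha> within UNIV)"
    proof (rule leibniz_rule_vector_derivative[where fx = "\<lambda>\<beta> s. ?V s \<beta>"])
      show "((\<lambda>\<beta>. f (xbar s \<beta>)) has_vector_derivative ?V s \<beta>) (at \<beta> within UNIV)" for s \<beta>
        using f_xbar_deriv[where u = "\<lambda>_. s" and v = "\<lambda>s. s"] xbar_deriv_alpha by auto
      show "(\<lambda>s. f (xbar s \<beta>)) integrable_on cbox q0 q" for \<beta>
        by (intro integrable_continuous continuous_intros)
      show "continuous_on (Sigma UNIV (\<lambda>_. cbox q0 q)) (\<lambda>(\<beta>, s). ?V s \<beta>)"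
        unfolding split_beta by (intro continuous_intros matrix_vector.continuous_on)
    qed auto
    \<comment> \<open>The same function of \<beta> is differentiated again, now through its closed
      form \<open>int\<close>; uniqueness of derivatives equates the two results.\<close>
    moreover have "((\<lambda>\<beta>. integral (cbox q0 q) (\<lambda>s. f (xbar s \<beta>))) has_vector_derivative
        x\<^sub>\<alpha> q \<alpha> - x\<^sub>\<alpha> q0 \<alpha>) (at \<alpha>)"
      unfolding int by (intro has_vector_derivative_diff xbar_deriv_alpha)
    ultimately show ?thesis
      using vector_derivative_unique_at by fastforce
  qed
  have "((\<lambda>q. x\<^sub>\<alpha> q0 \<alpha> + integral {q0..q} (\<lambda>s. ?V s \<alpha>)) has_vector_derivative ?V p \<alpha>)
      (at p within {q0..p + 1})"
    by (auto intro!: derivative_eq_intros integral_has_vector_derivative continuous_intros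
        matrix_vector.continuous_on simp: q0_def)
  then have "((\<lambda>q. x\<^sub>\<alpha> q \<alpha>) has_vector_derivative ?V p \<alpha>) (at p within {q0..p + 1})"
  proof (rule has_vector_derivative_transform[rotated 2])
    show "p \<in> {q0..p + 1}" by (simp add: q0_def)
    show "x\<^sub>\<alpha> q \<alpha> = x\<^sub>\<alpha> q0 \<alpha> + integral {q0..q} (\<lambda>s. ?V s \<alpha>)" if "q \<in> {q0..p + 1}" for q
      using that by (intro eq) simp
  qed
  moreover have "at p within {q0..p + 1} = at p"
    by (rule at_within_Icc_at) (auto simp: q0_def)
  ultimately show ?thesis
    by simp
qed

end

section \<open>The adjoint variational equation\<close>

lemma inner_transpose_mult:
  fixes A :: "real^3^3"
  shows "x \<bullet> (transpose A *v y) = (A *v x) \<bullet> y"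
  by (simp add: inner_vec_def matrix_vector_mult_def transpose_def sum_3 algebra_simps del: transpose_matrix_vector)

text \<open>The Rayleigh quotient. Along a solution of the adjoint equation it is the exponential
  rate at which the norm decays. It depends only on the line spanned by \<open>x\<close>, so the
  normal may be exchanged for any parallel vector with a known limit.\<close>

definition rayleigh :: "real^3^3 \<Rightarrow> real^3 \<Rightarrow> real" where
  "rayleigh A x = (x \<bullet> (A *v x)) / (x \<bullet> x)"

lemma rayleigh_parallel:
  fixes A :: "real^3^3"
  assumes "x \<times> y = 0" "x \<noteq> 0" "y \<noteq> 0"
  shows "rayleigh A x = rayleigh A y"
proof -
  obtain c where c: "y = c *\<^sub>R x"
    using assms cross_eq_0 collinear_lemma by metis
  with assms have "c \<noteq> 0" by auto
  then show ?thesis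
    by (simp add: rayleigh_def c matrix_vector.scaleR_right)
qed

text \<open>The product of \<open>\<phi> s\<close> and \<open>exp (k * s)\<close> has nonpositive
  derivative on the half line.\<close>

lemma gronwall_decay:
  fixes \<phi> :: "real \<Rightarrow> real"
  assumes "\<And>s. T \<le> s \<Longrightarrow> (\<phi> has_real_derivative \<phi>' s) (at s)"
    and "\<And>s. T \<le> s \<Longrightarrow> \<phi>' s \<le> - k * \<phi> s"
    and "T \<le> s"
  shows "\<phi> s \<le> \<phi> T * exp (- k * (s - T))"
proof -
  have "\<phi> s * exp (k * s) \<le> \<phi> T * exp (k * T)"
  proof (rule DERIV_nonpos_imp_nonincreasing[OF assms(3)], intro exI conjI)
    fix r assume r: "T \<le> r" "r \<le> s"
    show "((\<lambda>s. \<phi> s * exp (k * s)) has_real_derivative (\<phi>' r + k * \<phi> r) * exp (k * r)) (at r)"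
      by (auto intro!: derivative_eq_intros assms(1)[OF r(1)] simp: algebra_simps)
    show "(\<phi>' r + k * \<phi> r) * exp (k * r) \<le> 0"
      using assms(2)[OF r(1)] by (intro mult_nonpos_nonneg) auto
  qed
  then have "\<phi> s * exp (k * s) * exp (- k * s) \<le> \<phi> T * exp (k * T) * exp (- k * s)"
    by (intro mult_right_mono) auto
  then show ?thesis
    by (simp add: mult.assoc flip: exp_add) (simp add: algebra_simps)
qed

lemma integrable_exp_minus_abs:
  fixes k :: real
  assumes "k > 0"
  shows "integrable lborel (\<lambda>x::real. exp (- k * \<bar>x\<bar>))"
proof -
  have "(\<lambda>x::real. exp (- k * x)) absolutely_integrable_on {0..}"
    using has_integral_exp_minus_to_infinity[OF assms, of 0]
    by (intro nonnegative_absolutely_integrable_1) auto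
  then have I: "integrable lborel (\<lambda>x::real. indicator {0..} x *\<^sub>R exp (- k * x))"
    unfolding set_integrable_def by (subst (asm) integrable_completion) auto
  from lborel_integrable_real_affine[OF this, of "-1" 0]
  have "integrable lborel (\<lambda>x::real. indicator {0..} (- x) *\<^sub>R exp (- k * - x))" by simp
  \<comment> \<open>The half lines overlap at \<open>0\<close>, where the sum is 2; the sum
    dominates the integrand instead of equalling it.\<close>
  from Bochner_Integration.integrable_add[OF I this] show ?thesis
    by (rule Bochner_Integration.integrable_bound) (auto simp: indicator_def abs_if)
qed

lemma floor_quotient_bound:
  fixes m x :: real
  assumes "m > 0"
  shows "\<bar>of_int \<lfloor>m * x\<rfloor> / m - x\<bar> \<le> 1 / m"
proof -
  have "of_int \<lfloor>m * x\<rfloor> / m - x = (of_int \<lfloor>m * x\<rfloor> - m * x) / m"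
    using assms by (simp add: field_simps)
  moreover have "\<bar>of_int \<lfloor>m * x\<rfloor> - m * x\<bar> \<le> 1" by linarith
  ultimately show ?thesis
    using assms by (simp add: divide_right_mono)
qed

text \<open>In time \<open>g\<close> is only measurable, so joint measurability is not at hand. The
  curve is sampled at the grid points \<open>?q n \<tau>\<close>, which take countably many values;
  each sampled function is measurable piece by piece, and continuity in space gives pointwise
  convergence.\<close>

lemma borel_measurable_caratheodory_curve:
  fixes g :: "'a::metric_space \<Rightarrow> real \<Rightarrow> 'b::metric_space"
  assumes cont: "\<And>t. continuous_on S (\<lambda>x. g x t)"
    and meas: "\<And>x. x \<in> S \<Longrightarrow> g x \<in> borel_measurable borel"
    and c: "continuous_on UNIV c" "range c \<subseteq> S"
  shows "(\<lambda>\<tau>. g (c \<tau>) (\<tau> + r)) \<in> borel_measurable borel"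
proof (rule borel_measurable_LIMSEQ_metric)
  let ?q = "\<lambda>n \<tau>. of_int \<lfloor>real (Suc n) * \<tau>\<rfloor> / real (Suc n)"
  fix n
  show "(\<lambda>\<tau>. g (c (?q n \<tau>)) (\<tau> + r)) \<in> borel_measurable borel"
  proof (rule measurable_compose_countable[where g = "\<lambda>\<tau>. \<lfloor>real (Suc n) * \<tau>\<rfloor>"])
    fix i :: int
    have [measurable]: "g (c (of_int i / real (Suc n))) \<in> borel_measurable borel"
      using c by (intro meas) auto
    show "(\<lambda>\<tau>. g (c (of_int i / real (Suc n))) (\<tau> + r)) \<in> borel_measurable borel"
      by measurable
  qed measurable
next
  let ?q = "\<lambda>n \<tau>. of_int \<lfloor>real (Suc n) * \<tau>\<rfloor> / real (Suc n)"
  fix \<tau> :: real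
  have "(\<lambda>n. ?q n \<tau>) \<longlonglongrightarrow> \<tau>"
  proof (rule LIMSEQ_I)
    fix e :: real assume "e > 0"
    then obtain m where m: "1 / real (Suc m) < e" using nat_approx_posE by blast
    have "norm (?q n \<tau> - \<tau>) < e" if "n \<ge> m" for n
    proof -
      have "\<bar>?q n \<tau> - \<tau>\<bar> \<le> 1 / real (Suc n)"
        by (rule floor_quotient_bound) simp
      also have "\<dots> \<le> 1 / real (Suc m)" using that by (simp add: field_simps)
      finally show ?thesis using m by simp
    qed
    then show "\<exists>n0. \<forall>n\<ge>n0. norm (?q n \<tau> - \<tau>) < e" by blast
  qed
  then have "(\<lambda>n. c (?q n \<tau>)) \<longlonglongrightarrow> c \<tau>"
    using c(1) by (intro isCont_tendsto_compose[of _ c]) (auto simp: continuous_on_eq_continuous_at)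
  then show "(\<lambda>n. g (c (?q n \<tau>)) (\<tau> + r)) \<longlonglongrightarrow> g (c \<tau>) (\<tau> + r)"
    using c(2) by (intro continuous_on_tendsto_compose[OF cont] always_eventually) auto
qed

section \<open>The normal as a solution of the adjoint equation\<close>

context heteroclinic_system
begin

text \<open>Both factors of the normal, \<open>f (xbar q \<alpha>)\<close> and the
  \<alpha>-derivative of \<open>xbar\<close>, solve the variational equation along the trajectory,
  so \<open>cross_trace\<close> applies.\<close>

lemma normal_vec_deriv_p:
  "((\<lambda>q. N q \<alpha>) has_vector_derivative
      trace (J (xbar p \<alpha>)) *\<^sub>R N p \<alpha> - transpose (J (xbar p \<alpha>)) *v N p \<alpha>) (at p)"
proof -
  have f: "((\<lambda>q. f (xbar q \<alpha>)) has_vector_derivative J (xbar p \<alpha>) *v f (xbar p \<alpha>)) (at p)"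
    using f_xbar_deriv[where u = "\<lambda>s. s" and v = "\<lambda>_. \<alpha>"] param_flow by auto
  show ?thesis
    unfolding normal_vec_def
    using cross3.has_vector_derivative[OF f variational_equation[of \<alpha> p]]
      cross_trace[of "J (xbar p \<alpha>)" "f (xbar p \<alpha>)" "x\<^sub>\<alpha> p \<alpha>"]
    by (simp add: add.commute)
qed

lemma divergence_integral_deriv:
  "((\<lambda>\<tau>. LBINT \<xi>=ereal \<tau>..ereal p. divergence f (xbar \<xi> \<alpha>)) has_real_derivative
      - trace (J (xbar \<tau> \<alpha>))) (at \<tau>)"
proof -
  let ?h = "\<lambda>\<xi>. divergence f (xbar \<xi> \<alpha>)"
  \<comment> \<open>The margin 1 makes \<tau> interior to an interval that also contains
    \<open>p\<close>, so the derivative within the interval is the full derivative.\<close>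
  define l u where "l = min p \<tau> - 1" and "u = max p \<tau> + 1"
  have "continuous_on {l..u} ?h"
    unfolding divergence_def trace_def by (intro continuous_intros)
  then have "((\<lambda>\<tau>. LBINT \<xi>=ereal p..ereal \<tau>. ?h \<xi>) has_vector_derivative ?h \<tau>) (at \<tau> within {l..u})"
    by (intro interval_integral_FTC2) (auto simp: l_def u_def)
  moreover have "at \<tau> within {l..u} = at \<tau>"
    by (rule at_within_Icc_at) (auto simp: l_def u_def)
  ultimately have "((\<lambda>\<tau>. LBINT \<xi>=ereal p..ereal \<tau>. ?h \<xi>) has_real_derivative ?h \<tau>) (at \<tau>)"
    by (simp add: has_real_derivative_iff_has_vector_derivative)
  from DERIV_minus[OF this] show ?thesis
    by (subst interval_integral_endpoints_reverse) (simp add: divergence_def)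
qed

text \<open>The vector that the Melnikov integrand pairs with \<open>g\<close>. Differentiating the
  weight produces minus the trace, which cancels the trace term in the equation for \<open>N\<close>
  and leaves the adjoint variational equation.\<close>

definition weighted_normal :: "real \<Rightarrow> real \<Rightarrow> real \<Rightarrow> real^3" where
  "weighted_normal p \<alpha> \<tau> = exp (LBINT \<xi>=ereal \<tau>..ereal p. divergence f (xbar \<xi> \<alpha>)) *\<^sub>R N \<tau> \<alpha>"

lemma adjoint_equation:
  "(weighted_normal p \<alpha> has_vector_derivative - (transpose (J (xbar \<tau> \<alpha>)) *v weighted_normal p \<alpha> \<tau>)) (at \<tau>)"
proof -
  let ?I = "\<lambda>\<tau>. LBINT \<xi>=ereal \<tau>..ereal p. divergence f (xbar \<xi> \<alpha>)"
  have e: "((\<lambda>\<tau>. exp (?I \<tau>)) has_real_derivative exp (?I \<tau>) * - trace (J (xbar \<tau> \<alpha>))) (at \<tau>)"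
    by (intro DERIV_fun_exp divergence_integral_deriv)
  have "((\<lambda>\<tau>. exp (?I \<tau>) *\<^sub>R N \<tau> \<alpha>) has_vector_derivative
      exp (?I \<tau>) *\<^sub>R (trace (J (xbar \<tau> \<alpha>)) *\<^sub>R N \<tau> \<alpha> - transpose (J (xbar \<tau> \<alpha>)) *v N \<tau> \<alpha>)
      + (exp (?I \<tau>) * - trace (J (xbar \<tau> \<alpha>))) *\<^sub>R N \<tau> \<alpha>) (at \<tau>)"
    by (rule has_vector_derivative_scaleR[OF e normal_vec_deriv_p])
  moreover have "exp (?I \<tau>) *\<^sub>R (trace (J (xbar \<tau> \<alpha>)) *\<^sub>R N \<tau> \<alpha> - transpose (J (xbar \<tau> \<alpha>)) *v N \<tau> \<alpha>)
      + (exp (?I \<tau>) * - trace (J (xbar \<tau> \<alpha>))) *\<^sub>R N \<tau> \<alpha> = - (transpose (J (xbar \<tau> \<alpha>)) *v weighted_normal p \<alpha> \<tau>)"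
    by (simp add: weighted_normal_def matrix_vector.scaleR_right algebra_simps del: transpose_matrix_vector)
  ultimately show ?thesis
    unfolding weighted_normal_def by simp
qed

lemma weighted_normal_nonzero: "weighted_normal p \<alpha> \<tau> \<noteq> 0"
  using normal_nonzero by (simp add: weighted_normal_def)

lemma continuous_weighted_normal: "continuous_on S (weighted_normal p \<alpha>)"
  by (meson adjoint_equation continuous_at_imp_continuous_on has_vector_derivative_continuous)

text \<open>The adjoint equation yields the rate in terms of the weighted normal; since the weight
  is a positive scalar, the Rayleigh quotient may be taken at \<open>N\<close>, which does not
  involve \<open>p\<close>.\<close>

lemma norm_square_weighted_normal_deriv:
  "((\<lambda>\<tau>. weighted_normal p \<alpha> \<tau> \<bullet> weighted_normal p \<alpha> \<tau>) has_real_derivative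
     - 2 * rayleigh (J (xbar \<tau> \<alpha>)) (N \<tau> \<alpha>) * (weighted_normal p \<alpha> \<tau> \<bullet> weighted_normal p \<alpha> \<tau>)) (at \<tau>)"
proof -
  let ?w = "weighted_normal p \<alpha> \<tau>"
  have par: "N \<tau> \<alpha> \<times> ?w = 0"
    by (simp add: weighted_normal_def cross_mult_right)
  have "((\<lambda>\<tau>. weighted_normal p \<alpha> \<tau> \<bullet> weighted_normal p \<alpha> \<tau>) has_vector_derivative
      ?w \<bullet> (- (transpose (J (xbar \<tau> \<alpha>)) *v ?w)) + (- (transpose (J (xbar \<tau> \<alpha>)) *v ?w)) \<bullet> ?w) (at \<tau>)"
    by (rule bounded_bilinear.has_vector_derivative[OF bounded_bilinear_inner adjoint_equation adjoint_equation])
  moreover have "?w \<bullet> (- (transpose (J (xbar \<tau> \<alpha>)) *v ?w)) + (- (transpose (J (xbar \<tau> \<alpha>)) *v ?w)) \<bullet> ?w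
      = - 2 * rayleigh (J (xbar \<tau> \<alpha>)) ?w * (?w \<bullet> ?w)"
    using inner_transpose_mult[of ?w "J (xbar \<tau> \<alpha>)" ?w] weighted_normal_nonzero[of p \<alpha> \<tau>]
    by (simp add: rayleigh_def inner_commute del: transpose_matrix_vector)
  ultimately show ?thesis
    unfolding rayleigh_parallel[OF par normal_nonzero weighted_normal_nonzero]
    by (simp add: has_real_derivative_iff_has_vector_derivative)
qed

end

section \<open>Decay of the weighted normal\<close>

text \<open>Along a curve in \<open>S\<close> the function \<open>h\<close> is constantly zero near
  \<open>s\<close>, and the chain rule computes its derivative there as
  \<open>G (c s) \<bullet> v\<close>.\<close>

lemma tangent_orthogonal_gradient:
  fixes h :: "'a::euclidean_space \<Rightarrow> real"
  assumes h: "\<And>y. y \<in> U \<Longrightarrow> (h has_derivative (\<lambda>v. G y \<bullet> v)) (at y)"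
    and U: "open U" "S \<inter> U \<subseteq> {y. h y = 0}"
    and c: "(c has_vector_derivative v) (at s)" "c s \<in> U" "\<forall>\<^sub>F r in nhds s. c r \<in> S"
  shows "G (c s) \<bullet> v = 0"
proof -
  have "((\<lambda>r. h (c r)) has_derivative (\<lambda>r. G (c s) \<bullet> (r *\<^sub>R v))) (at s)"
    using has_derivative_compose[OF c(1)[unfolded has_vector_derivative_def] h[OF c(2)]] .
  then have 1: "((\<lambda>r. h (c r)) has_real_derivative G (c s) \<bullet> v) (at s)"
    by (rule has_derivative_imp_has_field_derivative) simp
  have "\<forall>\<^sub>F r in nhds s. c r \<in> U"
    using has_vector_derivative_continuous[OF c(1)] U(1) c(2)
    by (metis continuous_within tendsto_def eventually_nhds_conv_at)
  then have "\<forall>\<^sub>F r in nhds s. h (c r) = 0"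
    using c(3) by eventually_elim (use U(2) in auto)
  then have "((\<lambda>r. h (c r)) has_real_derivative 0) (at s)"
    by (subst DERIV_cong_ev[OF refl _ refl, where g = "\<lambda>_. 0"]) auto
  with 1 show ?thesis
    using DERIV_unique by blast
qed

lemma C2_on_gradient:
  fixes h :: "real^3 \<Rightarrow> real"
  assumes "C2_on U h"
  obtains G where "\<And>y. y \<in> U \<Longrightarrow> (h has_derivative (\<lambda>v. G y \<bullet> v)) (at y)"
    "continuous_on U G"
proof -
  obtain h' h'' where h': "\<And>x. x \<in> U \<Longrightarrow> (h has_derivative blinfun_apply (h' x)) (at x)"
      and h'': "\<And>x. x \<in> U \<Longrightarrow> (h' has_derivative blinfun_apply (h'' x)) (at x)"
    using assms unfolding C2_on_def by blast
  define G where "G = (\<lambda>y. \<Sum>b\<in>Basis. h' y b *\<^sub>R b)"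
  have "blinfun_apply (h' y) = (\<lambda>v. G y \<bullet> v)" for y
  proof
    fix v
    have "h' y v = h' y (\<Sum>b\<in>Basis. (v \<bullet> b) *\<^sub>R b)"
      by (simp add: euclidean_representation)
    also have "\<dots> = G y \<bullet> v"
      by (simp add: G_def blinfun.sum_right blinfun.scaleR_right inner_sum_left inner_commute[of v] mult.commute)
    finally show "h' y v = G y \<bullet> v" .
  qed
  moreover have "continuous_on U h'"
    using h'' by (rule has_derivative_imp_continuous_on)
  then have "continuous_on U G"
    unfolding G_def by (intro continuous_intros)
  ultimately show thesis
    using h' that[of G] by metis
qed

section \<open>Limit direction of the normal and exponential decay at both ends\<close>

context heteroclinic_system
begin

text \<open>Near \<open>e\<close> the surface is a level set of \<open>h\<close>, whose gradient
  \<open>G\<close> is continuous and nonzero at \<open>e\<close> too. Along the trajectory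
  \<open>N\<close> is parallel to \<open>G\<close>, so the Rayleigh quotients agree and converge to
  the one at \<open>G e\<close>. That vector is orthogonal to the tangent plane, hence a left
  eigenvector by \<open>left_eigenvector\<close>, and the limit is its eigenvalue. The filter
  \<open>F\<close> is left open so that both ends of time are covered.\<close>

lemma normal_direction_limit:
  assumes surf: "C2_surface (insert e (param_surface xbar))"
    and e: "e \<in> \<Omega>"
    and tangent: "tangent_vectors (insert e (param_surface xbar)) e = eigen_subspace (J e) Z"
    and split: "splits_one_two (J e) L Z"
    and cnj: "\<And>\<mu>. \<mu> \<in> Z \<Longrightarrow> cnj \<mu> \<in> Z"
    and disj: "\<And>l. l \<in> L \<Longrightarrow> complex_of_real l \<notin> Z"
    and lim: "((\<lambda>\<tau>. xbar \<tau> \<alpha>) \<longlongrightarrow> e) F"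
  shows "\<exists>l\<in>L. ((\<lambda>\<tau>. rayleigh (J (xbar \<tau> \<alpha>)) (N \<tau> \<alpha>)) \<longlongrightarrow> l) F"
proof -
  let ?S = "insert e (param_surface xbar)"
  have "\<exists>U (h :: real^3 \<Rightarrow> real). open U \<and> e \<in> U \<and> C2_on U h \<and>
      (\<forall>y\<in>U. frechet_derivative h (at y) \<noteq> (\<lambda>_. 0)) \<and> ?S \<inter> U = {y \<in> U. h y = 0}"
    using surf unfolding C2_surface_def by (rule bspec) simp
  then obtain U and h :: "real^3 \<Rightarrow> real" where U: "open U" "e \<in> U" and h: "C2_on U h"
    and nz: "\<forall>y\<in>U. frechet_derivative h (at y) \<noteq> (\<lambda>_. 0)"
    and SU: "?S \<inter> U = {y \<in> U. h y = 0}"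
    by (elim exE conjE) (rule that)
  obtain G where G: "\<And>y. y \<in> U \<Longrightarrow> (h has_derivative (\<lambda>v. G y \<bullet> v)) (at y)"
    and cG: "continuous_on U G"
    using C2_on_gradient[OF h] by blast
  have G0: "G y \<noteq> 0" if "y \<in> U" for y
    using nz that frechet_derivative_at[OF G[OF that]] by auto
  have "?S \<inter> U \<subseteq> {y. h y = 0}" using SU by blast
  note orth = tangent_orthogonal_gradient[OF G U(1) this]
  have "G e \<bullet> v = 0" if v: "v \<in> eigen_subspace (J e) Z" for v
  proof -
    obtain c where "c 0 = e" "(c has_vector_derivative v) (at 0)" "\<forall>\<^sub>F s in nhds (0::real). c s \<in> ?S"
      using v unfolding tangent[symmetric] tangent_vectors_def by blast
    then show ?thesis
      using orth[of c v 0] U(2) by simp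
  qed
  from left_eigenvector[OF split cnj disj this G0[OF U(2)]]
  obtain l where l: "l \<in> L" "transpose (J e) *v G e = l *\<^sub>R G e" by blast
  \<comment> \<open>Both factors of \<open>N\<close> are velocities of curves in the surface, hence
    orthogonal to \<open>G\<close>; Lagrange's formula writes the double cross product with these
    two inner products as coefficients.\<close>
  have par: "G (xbar \<tau> \<alpha>) \<times> N \<tau> \<alpha> = 0" if U': "xbar \<tau> \<alpha> \<in> U" for \<tau>
  proof -
    have "G (xbar \<tau> \<alpha>) \<bullet> f (xbar \<tau> \<alpha>) = 0"
      by (rule orth[OF _ param_flow U']) (auto simp: param_surface_def intro!: always_eventually)
    moreover have "G (xbar \<tau> \<alpha>) \<bullet> x\<^sub>\<alpha> \<tau> \<alpha> = 0"
      by (rule orth[OF _ xbar_deriv_alpha U']) (auto simp: param_surface_def intro!: always_eventually)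
    ultimately show ?thesis
      by (simp add: normal_vec_def Lagrange)
  qed
  have "isCont G e"
    using cG U by (simp add: continuous_on_eq_continuous_at)
  then have Gl: "((\<lambda>\<tau>. G (xbar \<tau> \<alpha>)) \<longlongrightarrow> G e) F"
    by (rule isCont_tendsto_compose[OF _ lim])
  have "isCont J e"
    using continuous_J open_domain e by (simp add: continuous_on_eq_continuous_at)
  then have Jl: "((\<lambda>\<tau>. J (xbar \<tau> \<alpha>)) \<longlongrightarrow> J e) F"
    by (rule isCont_tendsto_compose[OF _ lim])
  have "rayleigh (J e) (G e) = l"
    using inner_transpose_mult[of "G e" "J e" "G e"] l(2) G0[OF U(2)]
    by (simp add: rayleigh_def inner_commute field_simps del: transpose_matrix_vector)
  moreover have "((\<lambda>\<tau>. rayleigh (J (xbar \<tau> \<alpha>)) (G (xbar \<tau> \<alpha>))) \<longlongrightarrow> rayleigh (J e) (G e)) F"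
    unfolding rayleigh_def by (intro tendsto_intros matrix_vector.tendsto Gl Jl) (use G0[OF U(2)] in auto)
  moreover have "\<forall>\<^sub>F \<tau> in F. xbar \<tau> \<alpha> \<in> U"
    using lim U by (rule topological_tendstoD)
  then have "\<forall>\<^sub>F \<tau> in F. rayleigh (J (xbar \<tau> \<alpha>)) (G (xbar \<tau> \<alpha>)) = rayleigh (J (xbar \<tau> \<alpha>)) (N \<tau> \<alpha>)"
    by eventually_elim (intro rayleigh_parallel par G0 normal_nonzero)
  ultimately have "((\<lambda>\<tau>. rayleigh (J (xbar \<tau> \<alpha>)) (N \<tau> \<alpha>)) \<longlongrightarrow> l) F"
    by (simp add: tendsto_cong)
  then show ?thesis
    using l(1) by blast
qed

text \<open>The limit \<open>l\<close> is positive, being the real eigenvalue supplied by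
  \<open>spectrum_b\<close>. Giving up half of it, the squared norm eventually decays at rate
  \<open>l\<close>.\<close>

lemma weighted_normal_decay_at_top:
  "\<exists>T C k. k > 0 \<and> (\<forall>\<tau>\<ge>T. norm (weighted_normal p \<alpha> \<tau>) \<le> C * exp (- k * \<tau>))"
proof -
  let ?R = "\<lambda>\<tau>. rayleigh (J (xbar \<tau> \<alpha>)) (N \<tau> \<alpha>)"
  obtain l where l: "l > 0" "(?R \<longlongrightarrow> l) at_top"
    using normal_direction_limit[OF stable_smooth fixed_points(2) stable_tangent spectrum_b _ _ param_lim_b[of \<alpha>]]
    by auto
  then have "\<forall>\<^sub>F \<tau> in at_top. l / 2 < ?R \<tau>"
    by (intro order_tendstoD) auto
  then obtain T where T: "\<And>\<tau>. \<tau> \<ge> T \<Longrightarrow> l / 2 < ?R \<tau>"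
    by (auto simp: eventually_at_top_linorder)
  let ?\<phi> = "\<lambda>\<tau>. weighted_normal p \<alpha> \<tau> \<bullet> weighted_normal p \<alpha> \<tau>"
  have "?\<phi> \<tau> \<le> ?\<phi> T * exp (- l * (\<tau> - T))" if "\<tau> \<ge> T" for \<tau>
    using that
  proof (rule gronwall_decay[OF norm_square_weighted_normal_deriv, rotated])
    fix s assume "T \<le> s"
    then have "l / 2 * ?\<phi> s \<le> ?R s * ?\<phi> s"
      using T[of s] by (intro mult_right_mono) auto
    then show "- 2 * ?R s * ?\<phi> s \<le> - l * ?\<phi> s" by simp
  qed
  moreover have "norm (weighted_normal p \<alpha> \<tau>) = sqrt (?\<phi> \<tau>)" for \<tau> by (simp add: norm_eq_sqrt_inner)
  ultimately have "norm (weighted_normal p \<alpha> \<tau>) \<le> sqrt (?\<phi> T * exp (- l * (\<tau> - T)))" if "\<tau> \<ge> T" for \<tau>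
    using that by auto
  \<comment> \<open>The square root halves the rate, whence the witness \<open>l / 2\<close>; the
    shift by \<open>T\<close> goes into the constant.\<close>
  moreover have "sqrt (?\<phi> T * exp (- l * (\<tau> - T))) = norm (weighted_normal p \<alpha> T) * exp (l / 2 * T) * exp (- (l / 2) * \<tau>)" for \<tau>
  proof -
    have "exp (- l * (\<tau> - T)) = (exp (l / 2 * T) * exp (- (l / 2) * \<tau>))\<^sup>2"
      by (simp add: power2_eq_square flip: exp_add) (simp add: algebra_simps)
    then show ?thesis
      by (simp add: real_sqrt_mult norm_eq_sqrt_inner)
  qed
  ultimately show ?thesis
    using l(1) by (intro exI[of _ T] exI[of _ "norm (weighted_normal p \<alpha> T) * exp (l / 2 * T)"] exI[of _ "l / 2"]) auto
qed

text \<open>Mirror image at \<open>a\<close>, where \<open>spectrum_a\<close> makes \<open>l\<close>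
  negative and the norm decays as time runs backwards.\<close>

lemma weighted_normal_decay_at_bot:
  "\<exists>T C k. k > 0 \<and> (\<forall>\<tau>\<le>T. norm (weighted_normal p \<alpha> \<tau>) \<le> C * exp (k * \<tau>))"
proof -
  let ?R = "\<lambda>\<tau>. rayleigh (J (xbar \<tau> \<alpha>)) (N \<tau> \<alpha>)"
  obtain l where l: "l < 0" "(?R \<longlongrightarrow> l) at_bot"
    using normal_direction_limit[OF unstable_smooth fixed_points(1) unstable_tangent spectrum_a _ _ param_lim_a[of \<alpha>]]
    by auto
  then have "\<forall>\<^sub>F \<tau> in at_bot. ?R \<tau> < l / 2"
    by (intro order_tendstoD) auto
  then obtain T where T: "\<And>\<tau>. \<tau> \<le> T \<Longrightarrow> ?R \<tau> < l / 2"
    by (auto simp: eventually_at_bot_linorder)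
  let ?\<phi> = "\<lambda>\<tau>. weighted_normal p \<alpha> \<tau> \<bullet> weighted_normal p \<alpha> \<tau>"
  \<comment> \<open>Time is reversed to reuse the forward estimate; the double negations match
    \<open>gronwall_decay\<close> with \<open>- T\<close> for the start and \<open>- l\<close> for
    the rate.\<close>
  have "?\<phi> (- s) \<le> ?\<phi> (- (- T)) * exp (- (- l) * (s - (- T)))" if "s \<ge> - T" for s
    using that
  proof (rule gronwall_decay[rotated 2])
    fix s assume s: "- T \<le> s"
    show "((\<lambda>s. ?\<phi> (- s)) has_real_derivative 2 * ?R (- s) * ?\<phi> (- s)) (at s)"
      by (rule DERIV_cong[OF DERIV_chain2[OF norm_square_weighted_normal_deriv DERIV_minus[OF DERIV_ident]]]) simp
    have "?R (- s) * ?\<phi> (- s) \<le> l / 2 * ?\<phi> (- s)"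
      using T[of "- s"] s by (intro mult_right_mono) auto
    then show "2 * ?R (- s) * ?\<phi> (- s) \<le> - (- l) * ?\<phi> (- s)" by simp
  qed
  from this[of "- \<tau>" for \<tau>] have "?\<phi> \<tau> \<le> ?\<phi> T * exp (- l * (\<tau> - T))" if "\<tau> \<le> T" for \<tau>
    using that by (simp add: algebra_simps)
  moreover have "norm (weighted_normal p \<alpha> \<tau>) = sqrt (?\<phi> \<tau>)" for \<tau> by (simp add: norm_eq_sqrt_inner)
  ultimately have "norm (weighted_normal p \<alpha> \<tau>) \<le> sqrt (?\<phi> T * exp (- l * (\<tau> - T)))" if "\<tau> \<le> T" for \<tau>
    using that by auto
  moreover have "sqrt (?\<phi> T * exp (- l * (\<tau> - T))) = norm (weighted_normal p \<alpha> T) * exp (l / 2 * T) * exp (- (l / 2) * \<tau>)" for \<tau>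
  proof -
    have "exp (- l * (\<tau> - T)) = (exp (l / 2 * T) * exp (- (l / 2) * \<tau>))\<^sup>2"
      by (simp add: power2_eq_square flip: exp_add) (simp add: algebra_simps)
    then show ?thesis
      by (simp add: real_sqrt_mult norm_eq_sqrt_inner)
  qed
  ultimately show ?thesis
    using l(1) by (intro exI[of _ T] exI[of _ "norm (weighted_normal p \<alpha> T) * exp (l / 2 * T)"] exI[of _ "- (l / 2)"]) auto
qed

lemma weighted_normal_bound:
  "\<exists>C k. k > 0 \<and> (\<forall>\<tau>. norm (weighted_normal p \<alpha> \<tau>) \<le> C * exp (- k * \<bar>\<tau>\<bar>))"
proof -
  obtain T1 C1 k1 where 1: "k1 > 0" "\<And>\<tau>. \<tau> \<ge> T1 \<Longrightarrow> norm (weighted_normal p \<alpha> \<tau>) \<le> C1 * exp (- k1 * \<tau>)"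
    using weighted_normal_decay_at_top[of p \<alpha>] by blast
  obtain T2 C2 k2 where 2: "k2 > 0" "\<And>\<tau>. \<tau> \<le> T2 \<Longrightarrow> norm (weighted_normal p \<alpha> \<tau>) \<le> C2 * exp (k2 * \<tau>)"
    using weighted_normal_decay_at_bot[of p \<alpha>] by blast
  define k T where "k = min k1 k2" and "T = Max {\<bar>T1\<bar>, \<bar>T2\<bar>}"
  have T: "\<bar>T1\<bar> \<le> T" "\<bar>T2\<bar> \<le> T" by (auto simp: T_def)
  have "bounded (weighted_normal p \<alpha> ` {-T..T})"
    by (intro compact_imp_bounded compact_continuous_image continuous_weighted_normal) auto
  then obtain B where B: "\<forall>\<tau>\<in>{-T..T}. norm (weighted_normal p \<alpha> \<tau>) \<le> B"
    unfolding bounded_iff by auto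
  \<comment> \<open>The factor \<open>exp (k * T)\<close> makes the bound valid on the compact
    middle part, where \<open>exp (- k * \<bar>\<tau>\<bar>)\<close> may be as small as
    \<open>exp (- k * T)\<close>.\<close>
  define C where "C = \<bar>C1\<bar> + \<bar>C2\<bar> + \<bar>B\<bar> * exp (k * T)"
  have "0 \<le> \<bar>B\<bar> * exp (k * T)" by simp
  then have C: "0 \<le> C" "C1 \<le> C" "C2 \<le> C" "\<bar>B\<bar> * exp (k * T) \<le> C"
    unfolding C_def by linarith+
  have "norm (weighted_normal p \<alpha> \<tau>) \<le> C * exp (- k * \<bar>\<tau>\<bar>)" for \<tau>
  proof -
    consider "\<tau> > T" | "\<tau> < - T" | "\<tau> \<in> {-T..T}" by force
    then show ?thesis
    proof cases
      case 1
      then have "norm (weighted_normal p \<alpha> \<tau>) \<le> C1 * exp (- k1 * \<tau>)" using T by (intro \<open>\<And>\<tau>. \<tau> \<ge> T1 \<Longrightarrow> _\<close>) auto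
      also have "\<dots> \<le> C * exp (- k * \<bar>\<tau>\<bar>)"
        using 1 T by (intro mult_mono) (auto simp: C k_def intro!: mult_right_mono)
      finally show ?thesis .
    next
      case 2
      then have "norm (weighted_normal p \<alpha> \<tau>) \<le> C2 * exp (k2 * \<tau>)" using T by (intro \<open>\<And>\<tau>. \<tau> \<le> T2 \<Longrightarrow> _\<close>) auto
      also have "\<dots> \<le> C * exp (- k * \<bar>\<tau>\<bar>)"
        using 2 T by (intro mult_mono) (auto simp: C k_def intro!: mult_right_mono_neg)
      finally show ?thesis .
    next
      case 3
      then have "norm (weighted_normal p \<alpha> \<tau>) \<le> \<bar>B\<bar> * 1" using B by fastforce
      also have "\<dots> \<le> \<bar>B\<bar> * (exp (k * T) * exp (- k * \<bar>\<tau>\<bar>))"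
        using 3 \<open>k1 > 0\<close> \<open>k2 > 0\<close> by (intro mult_left_mono) (auto simp: k_def simp flip: exp_add right_diff_distrib)
      also have "\<dots> \<le> C * exp (- k * \<bar>\<tau>\<bar>)"
        unfolding mult.assoc[symmetric] by (intro mult_right_mono C) auto
      finally show ?thesis .
    qed
  qed
  then show ?thesis using 1(1) 2(1) by (intro exI[of _ C] exI[of _ k]) (auto simp: k_def)
qed

section \<open>Integrability and splitting of the Melnikov integral\<close>

lemma melnikov_integrand_eq:
  "melnikov_integrand f g xbar p \<alpha> t \<tau> = weighted_normal p \<alpha> \<tau> \<bullet> g (xbar \<tau> \<alpha>) (\<tau> + (t - p))"
  by (simp add: melnikov_integrand_def weighted_normal_def add_diff_eq)

text \<open>The dominating function is the exponential bound on the weighted normal times the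
  uniform bound on \<open>g\<close>. Integrability is what licenses additivity, since a
  non-integrable function gets integral 0 by default.\<close>

lemma melnikov_integrable: "integrable lborel (melnikov_integrand f g xbar p \<alpha> t)"
proof -
  obtain C k where Ck: "k > 0" "\<And>\<tau>. norm (weighted_normal p \<alpha> \<tau>) \<le> C * exp (- k * \<bar>\<tau>\<bar>)"
    using weighted_normal_bound by blast
  obtain K where K: "\<And>x t. x \<in> \<Omega> \<Longrightarrow> norm (g x t) \<le> K"
    using g_bounded by blast
  have [measurable]: "(\<lambda>\<tau>. g (xbar \<tau> \<alpha>) (\<tau> + (t - p))) \<in> borel_measurable borel"
  proof (rule borel_measurable_caratheodory_curve[where S = \<Omega> and g = g and c = "\<lambda>\<tau>. xbar \<tau> \<alpha>"])
    show "continuous_on \<Omega> (\<lambda>x. g x s)" for s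
      using g_C2 by (rule C2_on_imp_continuous_on)
    show "continuous_on UNIV (\<lambda>\<tau>. xbar \<tau> \<alpha>)"
      by (intro continuous_intros)
    show "range (\<lambda>\<tau>. xbar \<tau> \<alpha>) \<subseteq> \<Omega>"
      using xbar_in_domain by auto
  qed (rule g_measurable)
  have [measurable]: "weighted_normal p \<alpha> \<in> borel_measurable borel"
    by (intro borel_measurable_continuous_onI continuous_weighted_normal)
  show ?thesis
    unfolding melnikov_integrand_eq
  proof (rule Bochner_Integration.integrable_bound)
    show "integrable lborel (\<lambda>\<tau>. (C * K) * exp (- k * \<bar>\<tau>\<bar>))"
      using integrable_exp_minus_abs[OF Ck(1)] by (rule integrable_mult_right)
    show "AE \<tau> in lborel. norm (weighted_normal p \<alpha> \<tau> \<bullet> g (xbar \<tau> \<alpha>) (\<tau> + (t - p))) \<le> norm ((C * K) * exp (- k * \<bar>\<tau>\<bar>))"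
    proof (rule AE_I2)
      fix \<tau>
      have "norm (weighted_normal p \<alpha> \<tau> \<bullet> g (xbar \<tau> \<alpha>) (\<tau> + (t - p))) \<le> norm (weighted_normal p \<alpha> \<tau>) * norm (g (xbar \<tau> \<alpha>) (\<tau> + (t - p)))"
        by (simp add: Cauchy_Schwarz_ineq2)
      also have "\<dots> \<le> (C * exp (- k * \<bar>\<tau>\<bar>)) * K"
        using order_trans[OF norm_ge_zero Ck(2)] by (intro mult_mono Ck K xbar_in_domain) auto
      finally show "norm (weighted_normal p \<alpha> \<tau> \<bullet> g (xbar \<tau> \<alpha>) (\<tau> + (t - p))) \<le> norm ((C * K) * exp (- k * \<bar>\<tau>\<bar>))"
        by (simp add: mult_ac)
    qed
  qed measurable
qed

lemma melnikov_split: "melnikov f g xbar p \<alpha> t = melnikov_u f g xbar p \<alpha> t - melnikov_s f g xbar p \<alpha> t"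
proof -
  let ?m = "melnikov_integrand f g xbar p \<alpha> t"
  have I: "set_integrable lborel A ?m" if "A \<in> sets borel" for A
    using melnikov_integrable that unfolding set_integrable_def
    by (intro integrable_mult_indicator) auto
  have "melnikov f g xbar p \<alpha> t = (LINT \<tau>:{..p} \<union> {p<..}|lborel. ?m \<tau>)"
    unfolding melnikov_def set_lebesgue_integral_def
    by (intro Bochner_Integration.integral_cong) (auto simp: indicator_def)
  also have "\<dots> = (LINT \<tau>:{..p}|lborel. ?m \<tau>) + (LINT \<tau>:{p<..}|lborel. ?m \<tau>)"
    by (intro set_integral_Un I) auto
  \<comment> \<open>\<open>melnikov_s\<close> uses the closed half line; the endpoint
    \<open>p\<close> was removed for disjointness and is restored as a null set.\<close>
  also have "(LINT \<tau>:{p<..}|lborel. ?m \<tau>) = (LINT \<tau>:{p..}|lborel. ?m \<tau>)"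
  proof (rule set_integral_cong_set)
    show "AE x in lborel. (x \<in> {p..}) = (x \<in> {p<..})"
      using AE_lborel_singleton[of p] by eventually_elim auto
  qed (use I in \<open>auto simp: set_borel_measurable_def set_integrable_def\<close>)
  finally show ?thesis
    by (simp add: melnikov_u_def melnikov_s_def)
qed

end

section \<open>The flux across the strip\<close>

lemma norm_cross_le: "norm (x \<times> y) \<le> norm x * norm y"
proof -
  have "(norm (x \<times> y))\<^sup>2 \<le> (norm x * norm y)\<^sup>2"
    using norm_cross_dot[of x y] by (smt (verit) zero_le_power2)
  then show ?thesis
    by (rule power2_le_imp_le) simp
qed

text \<open>The unit square has area 1, so a uniform bound on the integrands carries over unchanged.
  Continuity allows the Lebesgue integrals to be exchanged for gauge integrals, where the bound is
  applied once in each variable.\<close>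

lemma iterated_integral_estimate:
  fixes I :: "real \<Rightarrow> real \<Rightarrow> real"
  assumes I: "continuous_on (Sigma {0..1} (\<lambda>_. {0..1})) (\<lambda>(\<alpha>, s). I \<alpha> s)"
    and m: "continuous_on {0..1} m"
    and B: "\<And>\<alpha> s. \<alpha> \<in> {0..1} \<Longrightarrow> s \<in> {0..1} \<Longrightarrow> \<bar>I \<alpha> s - m \<alpha>\<bar> \<le> B"
  shows "\<bar>(LBINT \<alpha>=0..1. (LBINT s=0..1. I \<alpha> s)) - (LBINT \<alpha>=0..1. m \<alpha>)\<bar> \<le> B"
proof -
  have LB: "(LBINT x=0..1. h x) = integral {0..1} h" if "continuous_on {0..1} h" for h :: "real \<Rightarrow> real"
    using interval_integral_eq_integral[of 0 1 h] that borel_integrable_atLeastAtMost'[of 0 1 h]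
    by (simp add: zero_ereal_def one_ereal_def)
  have cI: "continuous_on {0..1} (I \<alpha>)" if "\<alpha> \<in> {0..1}" for \<alpha>
    using continuous_on_compose2[OF I, of "{0..1}" "\<lambda>s. (\<alpha>, s)"] that
    by (auto simp: continuous_on_Pair image_subset_iff)
  have cint: "continuous_on {0..1} (\<lambda>\<alpha>. integral {0..1} (I \<alpha>))"
    using integral_continuous_on_param[of "{0..1}" 0 1 I] I by simp
  have inner: "(LBINT s=0..1. I \<alpha> s) = integral {0..1} (I \<alpha>)" if "\<alpha> \<in> {0..1}" for \<alpha>
    using LB cI[OF that] .
  have "(LBINT \<alpha>=0..1. (LBINT s=0..1. I \<alpha> s)) = (LBINT \<alpha>=0..1. integral {0..1} (I \<alpha>))"
    by (intro interval_integral_cong inner) (auto simp: einterval_def zero_ereal_def one_ereal_def)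
  also have "\<dots> = integral {0..1} (\<lambda>\<alpha>. integral {0..1} (I \<alpha>))"
    using cint by (rule LB)
  finally have eq: "(LBINT \<alpha>=0..1. (LBINT s=0..1. I \<alpha> s)) - (LBINT \<alpha>=0..1. m \<alpha>) =
      integral {0..1} (\<lambda>\<alpha>. integral {0..1} (I \<alpha>) - m \<alpha>)"
    using cint m by (simp add: LB Henstock_Kurzweil_Integration.integral_diff integrable_continuous_real)
  have "norm (integral {0..1} (I \<alpha>) - m \<alpha>) \<le> B" if "\<alpha> \<in> {0..1}" for \<alpha>
  proof -
    have "integral {0..1} (I \<alpha>) - m \<alpha> = integral {0..1} (\<lambda>s. I \<alpha> s - m \<alpha>)"
      using cI[OF that] by (simp add: Henstock_Kurzweil_Integration.integral_diff integrable_continuous_real)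
    also have "norm \<dots> \<le> B * (1 - 0)"
      using cI[OF that] B[OF that] by (intro integral_bound continuous_intros) auto
    finally show ?thesis by simp
  qed
  then have "norm (integral {0..1} (\<lambda>\<alpha>. integral {0..1} (I \<alpha>) - m \<alpha>)) \<le> B * (1 - 0)"
    using cint m by (intro integral_bound continuous_intros) auto
  then show ?thesis
    unfolding eq by simp
qed

text \<open>Boundedness of the coefficient \<open>m\<close> is derived: at one fixed small
  \<open>r\<close> both \<open>\<bar>d \<alpha> r\<bar> < 1\<close> and the expansion hold for all
  \<alpha>, which bounds \<open>m\<close> uniformly. The expansion then gives order
  \<epsilon>.\<close>

lemma expansion_order_eps:
  fixes d :: "'a \<Rightarrow> real \<Rightarrow> real"
  assumes exp: "\<exists>C. \<forall>\<^sub>F \<epsilon> in at_right 0. \<forall>\<alpha>. \<bar>d \<alpha> \<epsilon> - \<epsilon> * m \<alpha>\<bar> \<le> C * \<epsilon>\<^sup>2"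
    and lim: "uniform_limit UNIV (\<lambda>\<epsilon> \<alpha>. d \<alpha> \<epsilon>) (\<lambda>_. 0) (at_right 0)"
  shows "\<exists>B\<ge>0. \<forall>\<^sub>F \<epsilon> in at_right 0. \<forall>\<alpha>. \<bar>d \<alpha> \<epsilon>\<bar> \<le> B * \<epsilon>"
proof -
  obtain C where C: "\<forall>\<^sub>F \<epsilon> in at_right 0. \<forall>\<alpha>. \<bar>d \<alpha> \<epsilon> - \<epsilon> * m \<alpha>\<bar> \<le> C * \<epsilon>\<^sup>2"
    using exp by blast
  have small: "\<forall>\<^sub>F \<epsilon> in at_right 0. \<forall>\<alpha>. \<bar>d \<alpha> \<epsilon>\<bar> < 1"
    using uniform_limitD[OF lim, of 1] by simp
  have "\<forall>\<^sub>F \<epsilon> in at_right (0::real). \<epsilon> > 0"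
    by (simp add: eventually_at_right_less)
  then have "\<forall>\<^sub>F \<epsilon> in at_right 0. \<epsilon> > 0 \<and> (\<forall>\<alpha>. \<bar>d \<alpha> \<epsilon>\<bar> < 1) \<and> (\<forall>\<alpha>. \<bar>d \<alpha> \<epsilon> - \<epsilon> * m \<alpha>\<bar> \<le> C * \<epsilon>\<^sup>2)"
    using small C by eventually_elim auto
  then obtain r where r: "r > 0" "\<And>\<alpha>. \<bar>d \<alpha> r\<bar> < 1" "\<And>\<alpha>. \<bar>d \<alpha> r - r * m \<alpha>\<bar> \<le> C * r\<^sup>2"
    using eventually_happens'[OF trivial_limit_at_right_real] by blast
  \<comment> \<open>Solved from \<open>r * \<bar>m \<alpha>\<bar> \<le> 1 + \<bar>C\<bar> *
    r\<^sup>2\<close>; the absolute value covers a negative \<open>C\<close>.\<close>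
  define B0 where "B0 = (1 + \<bar>C\<bar> * r\<^sup>2) / r"
  have m: "\<bar>m \<alpha>\<bar> \<le> B0" for \<alpha>
  proof -
    have "r * \<bar>m \<alpha>\<bar> = \<bar>r * m \<alpha>\<bar>" using r(1) by (simp add: abs_mult)
    also have "\<dots> \<le> 1 + C * r\<^sup>2" using r(2,3)[of \<alpha>] by linarith
    also have "\<dots> \<le> 1 + \<bar>C\<bar> * r\<^sup>2" by (intro add_left_mono mult_right_mono) auto
    finally show ?thesis using r(1) by (simp add: B0_def field_simps)
  qed
  have B0: "B0 \<ge> 0" using r(1) by (simp add: B0_def)
  have "\<forall>\<^sub>F \<epsilon> in at_right (0::real). 0 < \<epsilon> \<and> \<epsilon> < 1"
    by (rule eventually_at_rightI[of _ 1]) auto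
  then have "\<forall>\<^sub>F \<epsilon> in at_right 0. \<forall>\<alpha>. \<bar>d \<alpha> \<epsilon>\<bar> \<le> (B0 + \<bar>C\<bar>) * \<epsilon>"
    using C
  proof eventually_elim
    case (elim \<epsilon>)
    show ?case
    proof
      fix \<alpha>
      have "C * \<epsilon>\<^sup>2 \<le> \<bar>C\<bar> * \<epsilon>"
        using elim(1) by (intro mult_mono) (auto simp: power2_eq_square intro: mult_left_le)
      moreover have "\<bar>\<epsilon> * m \<alpha>\<bar> \<le> B0 * \<epsilon>"
        using elim(1) m[of \<alpha>] by (simp add: abs_mult mult.commute)
      ultimately show "\<bar>d \<alpha> \<epsilon>\<bar> \<le> (B0 + \<bar>C\<bar>) * \<epsilon>"
        using elim(2)[rule_format, of \<alpha>] by (simp add: algebra_simps)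
    qed
  qed
  then show ?thesis using B0 by (intro exI[of _ "B0 + \<bar>C\<bar>"]) auto
qed

section \<open>The unit normal field and the flux density on the strip\<close>

context heteroclinic_system
begin

abbreviation n :: "real \<Rightarrow> real \<Rightarrow> real^3" where "n \<equiv> unit_normal f xbar"

lemma norm_unit_normal [simp]: "norm (n p \<alpha>) = 1"
  using normal_nonzero by (simp add: unit_normal_def norm_sgn)

lemma continuous_on_normal_vec [continuous_intros]:
  "continuous_on S u \<Longrightarrow> continuous_on S v \<Longrightarrow> continuous_on S (\<lambda>z. N (u z) (v z))"
  unfolding normal_vec_def by (intro cross3.continuous_on continuous_intros)

lemma continuous_on_unit_normal [continuous_intros]:
  "continuous_on S u \<Longrightarrow> continuous_on S v \<Longrightarrow> continuous_on S (\<lambda>z. n (u z) (v z))"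
  unfolding unit_normal_def sgn_div_norm
  by (intro continuous_intros) (auto simp: normal_nonzero)

lemma unit_normal_C1:
  "\<exists>n'. (\<forall>\<alpha>. (n p has_vector_derivative n' \<alpha>) (at \<alpha>)) \<and> continuous_on UNIV n'"
proof -
  obtain D where D: "\<And>\<alpha>. (x\<^sub>\<alpha> p has_vector_derivative D \<alpha>) (at \<alpha>)" "continuous_on UNIV D"
    using param_alpha_deriv_alpha by blast
  define N' where "N' \<alpha> = f (xbar p \<alpha>) \<times> D \<alpha> + (J (xbar p \<alpha>) *v x\<^sub>\<alpha> p \<alpha>) \<times> x\<^sub>\<alpha> p \<alpha>" for \<alpha>
  have fd: "((\<lambda>\<alpha>. f (xbar p \<alpha>)) has_vector_derivative J (xbar p \<alpha>) *v x\<^sub>\<alpha> p \<alpha>) (at \<alpha>)" for \<alpha>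
    using f_xbar_deriv[where u = "\<lambda>_. p" and v = "\<lambda>s. s"] xbar_deriv_alpha by auto
  have N': "(N p has_vector_derivative N' \<alpha>) (at \<alpha>)" for \<alpha>
    unfolding normal_vec_def N'_def by (rule cross3.has_vector_derivative[OF fd D(1)])
  have cN': "continuous_on UNIV N'"
    unfolding N'_def by (intro continuous_intros cross3.continuous_on matrix_vector.continuous_on D(2))
  \<comment> \<open>Product rule for \<open>N p \<alpha>\<close> scaled by the reciprocal of its
    norm; the second coefficient is the derivative of that reciprocal.\<close>
  define n' where "n' \<alpha> = (1 / norm (N p \<alpha>)) *\<^sub>R N' \<alpha>
      + (- (N p \<alpha> \<bullet> N' \<alpha>) / norm (N p \<alpha>) ^ 3) *\<^sub>R N p \<alpha>" for \<alpha>
  have "(n p has_vector_derivative n' \<alpha>) (at \<alpha>)" for \<alpha>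
  proof -
    have nN: "((\<lambda>\<alpha>. norm (N p \<alpha>)) has_real_derivative (N p \<alpha> \<bullet> N' \<alpha>) / norm (N p \<alpha>)) (at \<alpha>)"
      using has_derivative_compose[OF N'[of \<alpha>, unfolded has_vector_derivative_def] has_derivative_norm[OF normal_nonzero]]
      by (rule has_derivative_imp_has_field_derivative) (simp add: sgn_div_norm divide_inverse inner_commute mult_ac)
    have "((\<lambda>\<alpha>. 1 / norm (N p \<alpha>)) has_real_derivative - (N p \<alpha> \<bullet> N' \<alpha>) / norm (N p \<alpha>) ^ 3) (at \<alpha>)"
      using normal_nonzero[of p \<alpha>]
      by (auto intro!: derivative_eq_intros nN simp: power2_eq_square power3_eq_cube)
    from has_vector_derivative_scaleR[OF this N'] show ?thesis
      by (simp add: unit_normal_def[abs_def] sgn_div_norm n'_def inverse_eq_divide)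
  qed
  moreover have "continuous_on UNIV n'"
    unfolding n'_def by (intro continuous_intros cN') (auto simp: normal_nonzero)
  ultimately show ?thesis by blast
qed

text \<open>The derivative across the strip is a multiple of \<open>n\<close>. The part of the
  \<alpha>-derivative that carries \<open>du'\<close> and \<open>ds'\<close> is also a multiple of
  \<open>n\<close> and disappears in the cross product, so only the values of \<open>du\<close> and
  \<open>ds\<close> enter.\<close>

lemma strip_flux_density:
  fixes v :: "real^3 \<Rightarrow> real^3" and du ds :: "real \<Rightarrow> real \<Rightarrow> real \<Rightarrow> real \<Rightarrow> real" and s :: real
  assumes n': "(n p has_vector_derivative n') (at \<alpha>)"
    and du: "(\<lambda>\<alpha>. du p \<alpha> \<epsilon> t) differentiable (at \<alpha>)"
    and ds: "(\<lambda>\<alpha>. ds p \<alpha> \<epsilon> t) differentiable (at \<alpha>)"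
  defines "h \<equiv> s * du p \<alpha> \<epsilon> t + (1 - s) * ds p \<alpha> \<epsilon> t"
  shows "v (strip_chart f xbar du ds p \<epsilon> t s \<alpha>) \<bullet>
      (vector_derivative (\<lambda>\<beta>. strip_chart f xbar du ds p \<epsilon> t s \<beta>) (at \<alpha>) \<times>
       vector_derivative (\<lambda>\<sigma>. strip_chart f xbar du ds p \<epsilon> t \<sigma> \<alpha>) (at s)) =
    (du p \<alpha> \<epsilon> t - ds p \<alpha> \<epsilon> t) *
      (v (xbar p \<alpha> + h *\<^sub>R n p \<alpha>) \<bullet> ((x\<^sub>\<alpha> p \<alpha> + h *\<^sub>R n') \<times> n p \<alpha>))"
proof -
  obtain du' ds' where d': "((\<lambda>\<alpha>. du p \<alpha> \<epsilon> t) has_real_derivative du') (at \<alpha>)"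
      "((\<lambda>\<alpha>. ds p \<alpha> \<epsilon> t) has_real_derivative ds') (at \<alpha>)"
    using du ds by (metis real_differentiable_def)
  have h': "((\<lambda>\<alpha>. s * du p \<alpha> \<epsilon> t + (1 - s) * ds p \<alpha> \<epsilon> t) has_real_derivative s * du' + (1 - s) * ds') (at \<alpha>)"
    by (auto intro!: derivative_eq_intros d')
  have "((\<lambda>\<beta>. strip_chart f xbar du ds p \<epsilon> t s \<beta>) has_vector_derivative
      x\<^sub>\<alpha> p \<alpha> + (h *\<^sub>R n' + (s * du' + (1 - s) * ds') *\<^sub>R n p \<alpha>)) (at \<alpha>)"
    unfolding strip_chart_def h_def
    by (intro has_vector_derivative_add xbar_deriv_alpha has_vector_derivative_scaleR[OF h' n'])
  then have 1: "vector_derivative (\<lambda>\<beta>. strip_chart f xbar du ds p \<epsilon> t s \<beta>) (at \<alpha>) =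
      x\<^sub>\<alpha> p \<alpha> + (h *\<^sub>R n' + (s * du' + (1 - s) * ds') *\<^sub>R n p \<alpha>)"
    by (rule vector_derivative_at)
  have "((\<lambda>\<sigma>. strip_chart f xbar du ds p \<epsilon> t \<sigma> \<alpha>) has_vector_derivative
      (du p \<alpha> \<epsilon> t - ds p \<alpha> \<epsilon> t) *\<^sub>R n p \<alpha>) (at s)"
    unfolding strip_chart_def by (auto intro!: derivative_eq_intros simp: algebra_simps)
  then have 2: "vector_derivative (\<lambda>\<sigma>. strip_chart f xbar du ds p \<epsilon> t \<sigma> \<alpha>) (at s) =
      (du p \<alpha> \<epsilon> t - ds p \<alpha> \<epsilon> t) *\<^sub>R n p \<alpha>"
    by (rule vector_derivative_at)
  show ?thesis
    unfolding 1 2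
    by (simp add: strip_chart_def h_def cross_mult_right cross_mult_left cross_add_left)
qed

text \<open>At \<open>h = 0\<close> and \<open>\<epsilon> = 0\<close> the density is exactly
  \<open>norm (N p \<alpha>)\<close>. Three corrections remain: the variation of \<open>f\<close>
  across the strip, the perturbation \<open>g\<close>, and the turning of the normal
  \<open>n'\<close>, each at most linear in \<open>h\<close> or \<epsilon>.\<close>

lemma strip_density_estimate:
  assumes n': "continuous_on UNIV n'"
  shows "\<exists>\<rho>>0. \<exists>C\<ge>0. \<forall>\<alpha>\<in>{0..1}. \<forall>h \<epsilon>. \<bar>h\<bar> < \<rho> \<longrightarrow>
     xbar p \<alpha> + h *\<^sub>R n p \<alpha> \<in> \<Omega> \<and>
     \<bar>perturbed_field f g \<epsilon> (xbar p \<alpha> + h *\<^sub>R n p \<alpha>) t \<bullet> ((x\<^sub>\<alpha> p \<alpha> + h *\<^sub>R n' \<alpha>) \<times> n p \<alpha>)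
        - norm (N p \<alpha>)\<bar> \<le> C * (\<bar>h\<bar> + \<bar>\<epsilon>\<bar>)"
proof -
  have comp: "compact (xbar p ` {0..1})"
    by (intro compact_continuous_image continuous_intros) auto
  \<comment> \<open>Compactness of the closed curve gives one tube radius that keeps the strip
    inside \<open>\<Omega>\<close> for all \<alpha>.\<close>
  obtain \<rho>0 where \<rho>0: "\<rho>0 > 0" "(\<Union>x\<in>xbar p ` {0..1}. ball x \<rho>0) \<subseteq> \<Omega>"
    using compact_subset_open_imp_ball_epsilon_subset[OF comp open_domain] xbar_in_domain by blast
  have bounded: "\<exists>B\<ge>0. \<forall>\<alpha>\<in>{0..1}. norm (u \<alpha>) \<le> B" if "continuous_on {0..1} u" for u :: "real \<Rightarrow> real^3"
  proof -
    have "bounded (u ` {0..1})"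
      using that by (intro compact_imp_bounded compact_continuous_image) auto
    then obtain B where "\<forall>\<alpha>\<in>{0..1}. norm (u \<alpha>) \<le> B" unfolding bounded_iff by auto
    then show ?thesis by (intro exI[of _ "\<bar>B\<bar>"]) force
  qed
  have "continuous_on {0..1} (\<lambda>\<alpha>. x\<^sub>\<alpha> p \<alpha>)"
    by (intro continuous_intros)
  from bounded[OF this] obtain A1 where A1: "A1 \<ge> 0" "\<And>\<alpha>. \<alpha> \<in> {0..1} \<Longrightarrow> norm (x\<^sub>\<alpha> p \<alpha>) \<le> A1"
    by blast
  have "continuous_on {0..1} n'"
    using n' by (rule continuous_on_subset) simp
  from bounded[OF this] obtain A2 where A2: "A2 \<ge> 0" "\<And>\<alpha>. \<alpha> \<in> {0..1} \<Longrightarrow> norm (n' \<alpha>) \<le> A2"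
    by blast
  have "continuous_on {0..1} (\<lambda>\<alpha>. f (xbar p \<alpha>))"
    by (intro continuous_intros)
  from bounded[OF this] obtain F where F: "F \<ge> 0" "\<And>\<alpha>. \<alpha> \<in> {0..1} \<Longrightarrow> norm (f (xbar p \<alpha>)) \<le> F"
    by blast
  obtain L where L: "\<And>x. x \<in> \<Omega> \<Longrightarrow> norm (J x) \<le> L" using Df_bounded by blast
  obtain K where K: "\<And>x t. x \<in> \<Omega> \<Longrightarrow> norm (g x t) \<le> K" using g_bounded by blast
  have L0: "0 \<le> L" and K0: "0 \<le> K"
    using L[OF fixed_points(1)] K[OF fixed_points(1)] norm_ge_zero order_trans by blast+
  define A where "A = A1 + A2"
  define C where "C = L * A + K * A + F * A2"
  have "xbar p \<alpha> + h *\<^sub>R n p \<alpha> \<in> \<Omega> \<and>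
     \<bar>perturbed_field f g \<epsilon> (xbar p \<alpha> + h *\<^sub>R n p \<alpha>) t \<bullet> ((x\<^sub>\<alpha> p \<alpha> + h *\<^sub>R n' \<alpha>) \<times> n p \<alpha>)
        - norm (N p \<alpha>)\<bar> \<le> C * (\<bar>h\<bar> + \<bar>\<epsilon>\<bar>)"
    if \<alpha>: "\<alpha> \<in> {0..1}" and h: "\<bar>h\<bar> < min \<rho>0 1" for \<alpha> h \<epsilon>
  proof -
    let ?y = "xbar p \<alpha>" and ?n = "n p \<alpha>"
    let ?r = "?y + h *\<^sub>R ?n" and ?q = "x\<^sub>\<alpha> p \<alpha> + h *\<^sub>R n' \<alpha>"
    have ball: "ball ?y \<rho>0 \<subseteq> \<Omega>" using \<rho>0(2) \<alpha> by blast
    have rb: "?r \<in> ball ?y \<rho>0" using h by (simp add: dist_norm)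
    then have r: "?r \<in> \<Omega>" using ball by blast
    have fr: "norm (f ?r - f ?y) \<le> L * \<bar>h\<bar>"
    proof -
      have "norm (f ?r - f ?y) \<le> L * norm (?r - ?y)"
      \<comment> \<open>The mean value inequality wants a convex set; \<open>\<Omega>\<close> need
        not be convex, but the ball is.\<close>
      proof (rule differentiable_bound[OF convex_ball[of ?y \<rho>0]])
        fix x assume "x \<in> ball ?y \<rho>0"
        then have x: "x \<in> \<Omega>" using ball by blast
        show "(f has_derivative (\<lambda>h. J x *v h)) (at x within ball ?y \<rho>0)"
          using f_has_derivative[OF x] by (rule has_derivative_at_withinI)
        show "onorm (\<lambda>h. J x *v h) \<le> L"
          by (rule onorm_bound[OF L0])
             (use matrix_vector_norm_le[of "J x"] L[OF x] in \<open>meson mult_right_mono norm_ge_zero order_trans\<close>)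
      qed (use rb \<rho>0 in auto)
      then show ?thesis by simp
    qed
    have q: "norm (?q \<times> ?n) \<le> A"
    proof -
      have "norm (?q \<times> ?n) \<le> norm ?q"
        using norm_cross_le[of ?q ?n] by simp
      also have "\<dots> \<le> norm (x\<^sub>\<alpha> p \<alpha>) + \<bar>h\<bar> * norm (n' \<alpha>)"
        using norm_triangle_ineq[of "x\<^sub>\<alpha> p \<alpha>" "h *\<^sub>R n' \<alpha>"] by simp
      \<comment> \<open>Here \<open>\<bar>h\<bar> < 1\<close> is used, the reason for capping the
        radius at 1.\<close>
      also have "\<dots> \<le> A1 + 1 * A2"
        using h by (intro add_mono mult_mono A1 A2 \<alpha>) auto
      finally show ?thesis by (simp add: A_def)
    qed
    have nq: "norm ((h *\<^sub>R n' \<alpha>) \<times> ?n) \<le> \<bar>h\<bar> * A2"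
      using norm_cross_le[of "h *\<^sub>R n' \<alpha>" ?n] mult_left_mono[OF A2(2)[OF \<alpha>], of "\<bar>h\<bar>"] by simp
    \<comment> \<open>Cyclic symmetry of the triple product; then \<open>?n\<close> is the direction
      of \<open>N p \<alpha>\<close>.\<close>
    have "f ?y \<bullet> (x\<^sub>\<alpha> p \<alpha> \<times> ?n) = N p \<alpha> \<bullet> ?n"
      by (metis cross_triple inner_commute normal_vec_def)
    also have "\<dots> = norm (N p \<alpha>)"
      using normal_nonzero[of p \<alpha>]
      by (simp add: unit_normal_def sgn_div_norm power2_norm_eq_inner[symmetric] power2_eq_square)
    finally have main: "norm (N p \<alpha>) = f ?y \<bullet> (x\<^sub>\<alpha> p \<alpha> \<times> ?n)" by simp
    have decomp: "perturbed_field f g \<epsilon> ?r t \<bullet> (?q \<times> ?n) - norm (N p \<alpha>) =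
        (f ?r - f ?y) \<bullet> (?q \<times> ?n) + \<epsilon> * (g ?r t \<bullet> (?q \<times> ?n)) + f ?y \<bullet> ((h *\<^sub>R n' \<alpha>) \<times> ?n)"
      unfolding main perturbed_field_def
      by (simp add: inner_add_left inner_diff_left cross_add_left inner_add_right distrib_left)
    have "\<bar>perturbed_field f g \<epsilon> ?r t \<bullet> (?q \<times> ?n) - norm (N p \<alpha>)\<bar> \<le>
        \<bar>(f ?r - f ?y) \<bullet> (?q \<times> ?n)\<bar> + \<bar>\<epsilon>\<bar> * \<bar>g ?r t \<bullet> (?q \<times> ?n)\<bar>
        + \<bar>f ?y \<bullet> ((h *\<^sub>R n' \<alpha>) \<times> ?n)\<bar>"
      unfolding decomp abs_mult[symmetric] by linarith
    also have "\<dots> \<le> (L * \<bar>h\<bar>) * A + \<bar>\<epsilon>\<bar> * (K * A) + F * (\<bar>h\<bar> * A2)"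
    proof (intro add_mono mult_left_mono)
      show "\<bar>(f ?r - f ?y) \<bullet> (?q \<times> ?n)\<bar> \<le> (L * \<bar>h\<bar>) * A"
        using L0 by (intro order_trans[OF Cauchy_Schwarz_ineq2] mult_mono fr q) auto
      show "\<bar>g ?r t \<bullet> (?q \<times> ?n)\<bar> \<le> K * A"
        using K0 by (intro order_trans[OF Cauchy_Schwarz_ineq2] mult_mono K r q) auto
      show "\<bar>f ?y \<bullet> ((h *\<^sub>R n' \<alpha>) \<times> ?n)\<bar> \<le> F * (\<bar>h\<bar> * A2)"
        using F(1) by (intro order_trans[OF Cauchy_Schwarz_ineq2] mult_mono F(2)[OF \<alpha>] nq) auto
    qed simp
    also have "\<dots> \<le> C * (\<bar>h\<bar> + \<bar>\<epsilon>\<bar>)"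
    proof -
      \<comment> \<open>These are the mixed products that occur only on the right when
        \<open>C * (\<bar>h\<bar> + \<bar>\<epsilon>\<bar>)\<close> is expanded.\<close>
      have "0 \<le> L * A * \<bar>\<epsilon>\<bar>" "0 \<le> K * A * \<bar>h\<bar>" "0 \<le> F * A2 * \<bar>\<epsilon>\<bar>"
        using A1(1) A2(1) F(1) L0 K0 by (auto simp: A_def)
      then show ?thesis
        by (simp add: C_def algebra_simps)
    qed
    finally show ?thesis using r by blast
  qed
  then show ?thesis
    using \<rho>0(1) A1(1) A2(1) F(1) L0 K0
    by (intro exI[of _ "min \<rho>0 1"] conjI exI[of _ C]) (auto simp: C_def A_def)
qed

end

text \<open>Makes the Melnikov functions continuous in \<open>\<alpha>\<close> without dominated convergence.\<close>

lemma continuous_first_order_coefficient: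
  fixes m :: "real \<Rightarrow> real"
  assumes expansion: "\<forall>\<^sub>F \<epsilon> in at_right 0. \<forall>\<alpha>. \<bar>d \<alpha> \<epsilon> - \<epsilon> * m \<alpha>\<bar> \<le> C * \<epsilon>\<^sup>2"
    and cont: "\<forall>\<^sub>F \<epsilon> in at_right 0. continuous_on S (\<lambda>\<alpha>. d \<alpha> \<epsilon>)"
  shows "continuous_on S m"
proof (rule uniform_limit_theorem)
  show "\<forall>\<^sub>F \<epsilon> in at_right 0. continuous_on S (\<lambda>\<alpha>. d \<alpha> \<epsilon> / \<epsilon>)"
    using cont eventually_at_right_less[of 0] by eventually_elim (intro continuous_intros, auto)
  show "uniform_limit S (\<lambda>\<epsilon> \<alpha>. d \<alpha> \<epsilon> / \<epsilon>) m (at_right 0)"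
  proof (rule uniform_limitI)
    fix e :: real assume "e > 0"
    have "((\<lambda>\<epsilon>. C * \<epsilon>) \<longlongrightarrow> C * 0) (at_right 0)"
      by (intro tendsto_intros)
    then have "\<forall>\<^sub>F \<epsilon> in at_right 0. C * \<epsilon> < e"
      using \<open>e > 0\<close> by (intro order_tendstoD) auto
    then show "\<forall>\<^sub>F \<epsilon> in at_right 0. \<forall>\<alpha>\<in>S. dist (d \<alpha> \<epsilon> / \<epsilon>) (m \<alpha>) < e"
      using expansion eventually_at_right_less[of 0]
    proof eventually_elim
      case (elim \<epsilon>)
      have "dist (d \<alpha> \<epsilon> / \<epsilon>) (m \<alpha>) \<le> C * \<epsilon>" for \<alpha>
      proof -
        have "dist (d \<alpha> \<epsilon> / \<epsilon>) (m \<alpha>) = \<bar>d \<alpha> \<epsilon> - \<epsilon> * m \<alpha>\<bar> / \<epsilon>"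
          using elim(3) by (simp add: dist_real_def abs_div_pos[OF elim(3)] diff_divide_distrib)
        also have "\<dots> \<le> C * \<epsilon>\<^sup>2 / \<epsilon>"
          using elim(2,3) by (intro divide_right_mono) auto
        finally show ?thesis using elim(3) by (simp add: power2_eq_square)
      qed
      then show ?case using elim(1) by (meson le_less_trans)
    qed
  qed
qed simp

section \<open>First-order expansion of the flux\<close>

context heteroclinic_system
begin

text \<open>The flux density is compared pointwise with \<open>\<epsilon>\<close> times the Melnikov
  function on the unit square, with an error of second order uniform in \<alpha> and
  \<open>s\<close>; integrating preserves that error.\<close>

lemma lagrangian_flux_expansion:
  fixes du ds :: "real \<Rightarrow> real \<Rightarrow> real \<Rightarrow> real \<Rightarrow> real"
  assumes strip: "\<And>\<epsilon>. strip (\<Sigma> \<epsilon>) = strip_chart f xbar du ds p \<epsilon> t"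
    and du: "signed_normal_distance f xbar p Wu (\<lambda>\<alpha> \<epsilon>. du p \<alpha> \<epsilon> t)"
    and ds: "signed_normal_distance f xbar p Ws (\<lambda>\<alpha> \<epsilon>. ds p \<alpha> \<epsilon> t)"
    and du_expansion: "\<exists>C. \<forall>\<^sub>F \<epsilon> in at_right 0. \<forall>\<alpha>.
          \<bar>du p \<alpha> \<epsilon> t - \<epsilon> * melnikov_u f g xbar p \<alpha> t / norm (N p \<alpha>)\<bar> \<le> C * \<epsilon>\<^sup>2"
    and ds_expansion: "\<exists>C. \<forall>\<^sub>F \<epsilon> in at_right 0. \<forall>\<alpha>.
          \<bar>ds p \<alpha> \<epsilon> t - \<epsilon> * melnikov_s f g xbar p \<alpha> t / norm (N p \<alpha>)\<bar> \<le> C * \<epsilon>\<^sup>2"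
  shows "(\<lambda>\<epsilon>. lagrangian_flux (\<lambda>x. perturbed_field f g \<epsilon> x t) (\<Sigma> \<epsilon>)
            - \<epsilon> * (LBINT \<alpha>=0..1. melnikov f g xbar p \<alpha> t)) \<in> O[at_right 0](\<lambda>\<epsilon>. \<epsilon>\<^sup>2)"
proof -
  let ?d = "\<lambda>\<alpha> \<epsilon>. du p \<alpha> \<epsilon> t" and ?e = "\<lambda>\<alpha> \<epsilon>. ds p \<alpha> \<epsilon> t"
  let ?mu = "\<lambda>\<alpha>. melnikov_u f g xbar p \<alpha> t / norm (N p \<alpha>)"
  let ?ms = "\<lambda>\<alpha>. melnikov_s f g xbar p \<alpha> t / norm (N p \<alpha>)"
  let ?M = "\<lambda>\<alpha>. melnikov f g xbar p \<alpha> t"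
  obtain Cu where Cu: "\<forall>\<^sub>F \<epsilon> in at_right 0. \<forall>\<alpha>. \<bar>?d \<alpha> \<epsilon> - \<epsilon> * ?mu \<alpha>\<bar> \<le> Cu * \<epsilon>\<^sup>2"
    using du_expansion by auto
  obtain Cs where Cs: "\<forall>\<^sub>F \<epsilon> in at_right 0. \<forall>\<alpha>. \<bar>?e \<alpha> \<epsilon> - \<epsilon> * ?ms \<alpha>\<bar> \<le> Cs * \<epsilon>\<^sup>2"
    using ds_expansion by auto
  have du_diff: "\<forall>\<^sub>F \<epsilon> in at_right 0. \<forall>\<alpha>. (\<lambda>\<beta>. ?d \<beta> \<epsilon>) differentiable (at \<alpha>)"
    using du unfolding signed_normal_distance_def by (auto elim: eventually_mono)
  have ds_diff: "\<forall>\<^sub>F \<epsilon> in at_right 0. \<forall>\<alpha>. (\<lambda>\<beta>. ?e \<beta> \<epsilon>) differentiable (at \<alpha>)"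
    using ds unfolding signed_normal_distance_def by (auto elim: eventually_mono)
  have cont: "continuous_on A h" if "\<forall>\<alpha>. h differentiable (at \<alpha>)" for h :: "real \<Rightarrow> real" and A
    using that by (meson continuous_at_imp_continuous_on differentiable_imp_continuous_within)
  obtain Bu where Bu: "Bu \<ge> 0" "\<forall>\<^sub>F \<epsilon> in at_right 0. \<forall>\<alpha>. \<bar>?d \<alpha> \<epsilon>\<bar> \<le> Bu * \<epsilon>"
    using expansion_order_eps[of ?d ?mu] Cu du unfolding signed_normal_distance_def by blast
  obtain Bs where Bs: "Bs \<ge> 0" "\<forall>\<^sub>F \<epsilon> in at_right 0. \<forall>\<alpha>. \<bar>?e \<alpha> \<epsilon>\<bar> \<le> Bs * \<epsilon>"
    using expansion_order_eps[of ?e ?ms] Cs ds unfolding signed_normal_distance_def by blast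
  define B where "B = max Bu Bs"
  have B0: "B \<ge> 0" using Bu(1) by (simp add: B_def)
  obtain n' where n': "\<And>\<alpha>. (n p has_vector_derivative n' \<alpha>) (at \<alpha>)" "continuous_on UNIV n'"
    using unit_normal_C1 by blast
  obtain \<rho> K where \<rho>: "\<rho> > 0" and K: "K \<ge> 0"
    and est: "\<And>\<alpha> h \<epsilon>. \<alpha> \<in> {0..1} \<Longrightarrow> \<bar>h\<bar> < \<rho> \<Longrightarrow> xbar p \<alpha> + h *\<^sub>R n p \<alpha> \<in> \<Omega> \<and>
     \<bar>perturbed_field f g \<epsilon> (xbar p \<alpha> + h *\<^sub>R n p \<alpha>) t \<bullet> ((x\<^sub>\<alpha> p \<alpha> + h *\<^sub>R n' \<alpha>) \<times> n p \<alpha>)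
        - norm (N p \<alpha>)\<bar> \<le> K * (\<bar>h\<bar> + \<bar>\<epsilon>\<bar>)"
    using strip_density_estimate[OF n'(2), of p t] by blast
  have cN: "continuous_on A (\<lambda>\<alpha>. norm (N p \<alpha>))" for A
    by (intro continuous_intros)
  have "bounded ((\<lambda>\<alpha>. norm (N p \<alpha>)) ` {0..1})"
    by (intro compact_imp_bounded compact_continuous_image cN) auto
  then obtain A where A: "\<forall>\<alpha>\<in>{0..1}. norm (N p \<alpha>) \<le> A"
    unfolding bounded_iff by auto
  have M: "?M \<alpha> = norm (N p \<alpha>) * (?mu \<alpha> - ?ms \<alpha>)" for \<alpha>
    using normal_nonzero[of p \<alpha>] by (simp add: melnikov_split field_simps)
  have "\<forall>\<^sub>F \<epsilon> in at_right 0. continuous_on {0..1} (\<lambda>\<alpha>. ?d \<alpha> \<epsilon>)"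
    using du_diff by eventually_elim (rule cont)
  with Cu have cmu: "continuous_on {0..1} ?mu" by (rule continuous_first_order_coefficient)
  have "\<forall>\<^sub>F \<epsilon> in at_right 0. continuous_on {0..1} (\<lambda>\<alpha>. ?e \<alpha> \<epsilon>)"
    using ds_diff by eventually_elim (rule cont)
  with Cs have cms: "continuous_on {0..1} ?ms" by (rule continuous_first_order_coefficient)
  have cM: "continuous_on {0..1} ?M"
    unfolding M by (intro continuous_on_mult continuous_on_diff cmu cms cN)
  \<comment> \<open>First term: \<open>\<bar>?d \<alpha> \<epsilon> - ?e \<alpha> \<epsilon>\<bar>
    \<le> 2 * B * \<epsilon>\<close> times the density error
    \<open>K * (B + 1) * \<epsilon>\<close>. Second term: the errors of the two distance expansions,
    scaled by the bound \<open>A\<close> on the normal.\<close>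
  define Q where "Q = 2 * B * (K * (B + 1)) + A * (Cu + Cs)"
  have "((\<lambda>\<epsilon>. B * \<epsilon>) \<longlongrightarrow> B * 0) (at_right 0)"
    by (intro tendsto_intros)
  then have small: "\<forall>\<^sub>F \<epsilon> in at_right 0. B * \<epsilon> < \<rho>"
    using \<rho> by (intro order_tendstoD) auto
  have "\<forall>\<^sub>F \<epsilon> in at_right 0. norm (lagrangian_flux (\<lambda>x. perturbed_field f g \<epsilon> x t) (\<Sigma> \<epsilon>)
            - \<epsilon> * (LBINT \<alpha>=0..1. ?M \<alpha>)) \<le> Q * norm (\<epsilon>\<^sup>2)"
    using eventually_at_right_less[of 0] small du_diff ds_diff Bu(2) Bs(2) Cu Cs
  proof eventually_elim
    case (elim \<epsilon>)
    let ?v = "\<lambda>x. perturbed_field f g \<epsilon> x t"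
    define h where "h \<alpha> s = s * ?d \<alpha> \<epsilon> + (1 - s) * ?e \<alpha> \<epsilon>" for \<alpha> s
    define P where "P \<alpha> s = ?v (xbar p \<alpha> + h \<alpha> s *\<^sub>R n p \<alpha>) \<bullet> ((x\<^sub>\<alpha> p \<alpha> + h \<alpha> s *\<^sub>R n' \<alpha>) \<times> n p \<alpha>)" for \<alpha> s
    define I where "I \<alpha> s = (?d \<alpha> \<epsilon> - ?e \<alpha> \<epsilon>) * P \<alpha> s" for \<alpha> s
    have dB: "\<bar>?d \<alpha> \<epsilon>\<bar> \<le> B * \<epsilon>" and eB: "\<bar>?e \<alpha> \<epsilon>\<bar> \<le> B * \<epsilon>" for \<alpha>
    proof -
      have "Bu * \<epsilon> \<le> B * \<epsilon>" "Bs * \<epsilon> \<le> B * \<epsilon>"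
        using elim(1) by (auto simp: B_def)
      then show "\<bar>?d \<alpha> \<epsilon>\<bar> \<le> B * \<epsilon>" "\<bar>?e \<alpha> \<epsilon>\<bar> \<le> B * \<epsilon>"
        using elim(5,6) order_trans by blast+
    qed
    \<comment> \<open>For \<open>s\<close> in the unit interval \<open>h\<close> is a convex
      combination of the two distances.\<close>
    have hB: "\<bar>h \<alpha> s\<bar> \<le> B * \<epsilon>" if "s \<in> {0..1}" for \<alpha> s
    proof -
      have "\<bar>h \<alpha> s\<bar> \<le> s * \<bar>?d \<alpha> \<epsilon>\<bar> + (1 - s) * \<bar>?e \<alpha> \<epsilon>\<bar>"
        unfolding h_def using that by (intro order_trans[OF abs_triangle_ineq]) (simp add: abs_mult)
      also have "\<dots> \<le> s * (B * \<epsilon>) + (1 - s) * (B * \<epsilon>)"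
        using that by (intro add_mono mult_left_mono dB eB) auto
      finally show ?thesis by (simp add: algebra_simps)
    qed
    have flux: "lagrangian_flux ?v (\<Sigma> \<epsilon>) = (LBINT \<alpha>=0..1. (LBINT s=0..1. I \<alpha> s))"
      unfolding lagrangian_flux_def strip I_def P_def h_def
      using elim(3,4) by (subst strip_flux_density[OF n'(1)]) auto
    have cI: "continuous_on (Sigma {0..1} (\<lambda>_. {0..1})) (\<lambda>(\<alpha>, s). I \<alpha> s)"
    proof -
      let ?R = "Sigma {0..1} (\<lambda>_. {0..1}) :: (real \<times> real) set"
      let ?r = "\<lambda>z. xbar p (fst z) + h (fst z) (snd z) *\<^sub>R n p (fst z)"
      have cd: "continuous_on ?R (\<lambda>z. ?d (fst z) \<epsilon>)"
        by (rule continuous_on_compose2[where g = "\<lambda>\<alpha>. ?d \<alpha> \<epsilon>" and f = fst and t = UNIV, OF cont[OF elim(3)]])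
           (auto intro: continuous_intros)
      have ce: "continuous_on ?R (\<lambda>z. ?e (fst z) \<epsilon>)"
        by (rule continuous_on_compose2[where g = "\<lambda>\<alpha>. ?e \<alpha> \<epsilon>" and f = fst and t = UNIV, OF cont[OF elim(4)]])
           (auto intro: continuous_intros)
      have ch: "continuous_on ?R (\<lambda>z. h (fst z) (snd z))"
        unfolding h_def by (intro continuous_intros cd ce)
      have cr: "continuous_on ?R ?r"
        by (intro continuous_intros ch)
      \<comment> \<open>Because \<open>B * \<epsilon> < \<rho>\<close>, the strip lies in
        \<open>\<Omega>\<close>, the set on which \<open>f\<close> and \<open>g\<close> are known to
        be continuous.\<close>
      have r: "?r ` ?R \<subseteq> \<Omega>"
      proof
        fix x assume "x \<in> ?r ` ?R"
        then obtain \<alpha> s where "\<alpha> \<in> {0..1}" "s \<in> {0..1}" and x: "x = xbar p \<alpha> + h \<alpha> s *\<^sub>R n p \<alpha>"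
          by auto
        with est[of \<alpha> "h \<alpha> s"] le_less_trans[OF hB elim(2)] show "x \<in> \<Omega>"
          by simp
      qed
      have cv: "continuous_on ?R (\<lambda>z. ?v (?r z))"
        unfolding perturbed_field_def
        by (intro continuous_on_add continuous_on_scaleR continuous_on_const
            continuous_on_compose2[OF continuous_f cr r]
            continuous_on_compose2[OF C2_on_imp_continuous_on[OF g_C2] cr r])
      have cn: "continuous_on ?R (\<lambda>z. n' (fst z))"
        by (rule continuous_on_compose2[OF n'(2)]) (auto intro: continuous_intros)
      show ?thesis
        unfolding I_def P_def split_beta
        by (intro continuous_on_mult continuous_on_diff continuous_on_inner cross3.continuous_on
            cd ce cv continuous_on_add continuous_on_scaleR ch cn continuous_on_param_alpha
            continuous_on_unit_normal continuous_on_const continuous_on_fst continuous_on_id)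
    qed
    have bound: "\<bar>I \<alpha> s - \<epsilon> * ?M \<alpha>\<bar> \<le> Q * \<epsilon>\<^sup>2" if \<alpha>: "\<alpha> \<in> {0..1}" and s: "s \<in> {0..1}" for \<alpha> s
    proof -
      have "\<bar>P \<alpha> s - norm (N p \<alpha>)\<bar> \<le> K * (\<bar>h \<alpha> s\<bar> + \<bar>\<epsilon>\<bar>)"
        unfolding P_def using est[OF \<alpha>] hB[OF s] elim(2) by (meson le_less_trans)
      also have "\<dots> \<le> K * (B * \<epsilon> + \<epsilon>)"
        using K hB[OF s] elim(1) by (intro mult_left_mono add_mono) auto
      finally have 1: "\<bar>P \<alpha> s - norm (N p \<alpha>)\<bar> \<le> K * (B * \<epsilon> + \<epsilon>)" .
      have 2: "\<bar>?d \<alpha> \<epsilon> - ?e \<alpha> \<epsilon>\<bar> \<le> 2 * (B * \<epsilon>)"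
        using dB[of \<alpha>] eB[of \<alpha>] by linarith
      have "\<bar>(?d \<alpha> \<epsilon> - \<epsilon> * ?mu \<alpha>) - (?e \<alpha> \<epsilon> - \<epsilon> * ?ms \<alpha>)\<bar> \<le> Cu * \<epsilon>\<^sup>2 + Cs * \<epsilon>\<^sup>2"
        using elim(7,8)[rule_format, of \<alpha>] by linarith
      then have 3: "\<bar>(?d \<alpha> \<epsilon> - ?e \<alpha> \<epsilon>) - \<epsilon> * (?mu \<alpha> - ?ms \<alpha>)\<bar> \<le> (Cu + Cs) * \<epsilon>\<^sup>2"
        by (simp add: algebra_simps)
      \<comment> \<open>The product of the width and \<open>norm (N p \<alpha>)\<close> is added and
        subtracted, separating the error in the density from the error in the width.\<close>
      have decomp: "I \<alpha> s - \<epsilon> * ?M \<alpha> = (?d \<alpha> \<epsilon> - ?e \<alpha> \<epsilon>) * (P \<alpha> s - norm (N p \<alpha>))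
          + norm (N p \<alpha>) * ((?d \<alpha> \<epsilon> - ?e \<alpha> \<epsilon>) - \<epsilon> * (?mu \<alpha> - ?ms \<alpha>))"
        unfolding I_def M by (simp add: algebra_simps)
      have "\<bar>I \<alpha> s - \<epsilon> * ?M \<alpha>\<bar> \<le> \<bar>?d \<alpha> \<epsilon> - ?e \<alpha> \<epsilon>\<bar> * \<bar>P \<alpha> s - norm (N p \<alpha>)\<bar>
          + norm (N p \<alpha>) * \<bar>(?d \<alpha> \<epsilon> - ?e \<alpha> \<epsilon>) - \<epsilon> * (?mu \<alpha> - ?ms \<alpha>)\<bar>"
        unfolding decomp by (rule order_trans[OF abs_triangle_ineq]) (simp add: abs_mult)
      also have "\<dots> \<le> (2 * (B * \<epsilon>)) * (K * (B * \<epsilon> + \<epsilon>)) + A * ((Cu + Cs) * \<epsilon>\<^sup>2)"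
        using B0 elim(1) A \<alpha> by (intro add_mono mult_mono 1 2 3) (auto intro: order_trans[OF norm_ge_zero])
      also have "\<dots> = Q * \<epsilon>\<^sup>2"
        by (simp add: Q_def algebra_simps power2_eq_square)
      finally show ?thesis .
    qed
    have "\<bar>(LBINT \<alpha>=0..1. (LBINT s=0..1. I \<alpha> s)) - (LBINT \<alpha>=0..1. \<epsilon> * ?M \<alpha>)\<bar> \<le> Q * \<epsilon>\<^sup>2"
      using cI _ bound by (rule iterated_integral_estimate) (intro continuous_intros cM)
    then show ?case
      unfolding flux by simp
  qed
  then show ?thesis
    by (rule bigoI)
qed

end

theorem theorem7:
  fixes \<Omega> :: "(real^3) set"
    and f :: "real^3 \<Rightarrow> real^3"
    and g :: "real^3 \<Rightarrow> real \<Rightarrow> real^3"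
    and a b :: "real^3"
    and xbar :: "real \<Rightarrow> real \<Rightarrow> real^3"
    and a\<^sub>\<epsilon> b\<^sub>\<epsilon> :: "real \<Rightarrow> real \<Rightarrow> real^3"
    and \<Gamma>u \<Gamma>s :: "real \<Rightarrow> real \<Rightarrow> (real^3) set"
    and du ds :: "real \<Rightarrow> real \<Rightarrow> real \<Rightarrow> real \<Rightarrow> real"
    and \<Phi> :: "real \<Rightarrow> real \<Rightarrow> real \<Rightarrow> real"
    and p t :: real
  assumes system: "heteroclinic_system \<Omega> f g a b xbar"
    and hyperbolic_a: "\<forall>\<^sub>F \<epsilon> in at_right 0. hyperbolic_trajectory \<Omega> (perturbed_field f g \<epsilon>) 1 (a\<^sub>\<epsilon> \<epsilon>)"
    and hyperbolic_b: "\<forall>\<^sub>F \<epsilon> in at_right 0. hyperbolic_trajectory \<Omega> (perturbed_field f g \<epsilon>) 2 (b\<^sub>\<epsilon> \<epsilon>)"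
    and persist_a: "uniform_limit UNIV a\<^sub>\<epsilon> (\<lambda>_. a) (at_right 0)"
    and persist_b: "uniform_limit UNIV b\<^sub>\<epsilon> (\<lambda>_. b) (at_right 0)"
    and \<Gamma>u_def: "\<And>\<epsilon> t. \<Gamma>u \<epsilon> t = unstable_manifold \<Omega> (perturbed_field f g \<epsilon>) (a\<^sub>\<epsilon> \<epsilon>) t"
    and \<Gamma>s_def: "\<And>\<epsilon> t. \<Gamma>s \<epsilon> t = stable_manifold \<Omega> (perturbed_field f g \<epsilon>) (b\<^sub>\<epsilon> \<epsilon>) t"
    and du_distance: "signed_normal_distance f xbar p (\<lambda>\<epsilon>. \<Gamma>u \<epsilon> t) (\<lambda>\<alpha> \<epsilon>. du p \<alpha> \<epsilon> t)"
    and ds_distance: "signed_normal_distance f xbar p (\<lambda>\<epsilon>. \<Gamma>s \<epsilon> t) (\<lambda>\<alpha> \<epsilon>. ds p \<alpha> \<epsilon> t)"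
    and du_expansion: "\<exists>C. \<forall>\<^sub>F \<epsilon> in at_right 0. \<forall>\<alpha>.
          \<bar>du p \<alpha> \<epsilon> t - \<epsilon> * melnikov_u f g xbar p \<alpha> t / norm (normal_vec f xbar p \<alpha>)\<bar> \<le> C * \<epsilon>\<^sup>2"
    and ds_expansion: "\<exists>C. \<forall>\<^sub>F \<epsilon> in at_right 0. \<forall>\<alpha>.
          \<bar>ds p \<alpha> \<epsilon> t - \<epsilon> * melnikov_s f g xbar p \<alpha> t / norm (normal_vec f xbar p \<alpha>)\<bar> \<le> C * \<epsilon>\<^sup>2"
    and flux_def: "\<And>p t \<epsilon>. \<Phi> p t \<epsilon> = lagrangian_flux (\<lambda>x. perturbed_field f g \<epsilon> x t)
          (pseudo_separatrix_of (\<Gamma>u \<epsilon> t) (a\<^sub>\<epsilon> \<epsilon> t) (\<Gamma>s \<epsilon> t) (b\<^sub>\<epsilon> \<epsilon> t)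
             (strip_chart f xbar du ds p \<epsilon> t))"
  shows "(\<lambda>\<epsilon>. \<Phi> p t \<epsilon> - \<epsilon> * (LBINT \<alpha>=0..1. melnikov f g xbar p \<alpha> t))
           \<in> O[at_right 0](\<lambda>\<epsilon>. \<epsilon>\<^sup>2)"
  \<comment> \<open>The flow carries the two manifold parts, so \<open>lagrangian_flux\<close> reads
    the \<open>strip\<close> field of the record, which is the chart built from \<open>du\<close>
    and \<open>ds\<close>.\<close>
  unfolding flux_def
  by (rule heteroclinic_system.lagrangian_flux_expansion
      [where du = du and ds = ds and p = p and t = t, OF system _ du_distance ds_distance du_expansion ds_expansion])
     (simp add: pseudo_separatrix_of_def)

end
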